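(* Let $G$ be an infinite finitely generated group with a finite symmetric generating set $S$, and let $H$ be a nontrivial finitely generated group. Suppose either (i) $G$ is not virtually-$\mathbb{Z}$ and $H$ is finite, with switch measure $\mu$ uniform on $H$, or (ii) $H$ is infinite, with switch measure $\mu$ a finitely supported, symmetric and non-degenerate probability measure on $H$. Then for every $\lambda\ge1$ the $\lambda$-stationary random walk on $H\wr G$ with switch measure $\mu$ is transient.
   Context: The lamplighter group $H\wr G$ consists of pairs $((L(g))_{g\in G},x)$ with $L:G\to H$ finitely supported and $x\in G$; its identity has all lamps $\mathrm{id}_H$ and $x=\mathrm{id}_G$. The $\lambda$-homesick random walk ($\lambda\ge1$) on $\mathrm{Cay}(G,S)$ (vertices $G$, $g$ adjacent to $gs$, $s\in S$) rooted at $o=\mathrm{id}_G$: $Z_0=o$; at vertex $v$ with neighbors $v_1,\dots,v_j$ at distance $\mathrm{dist}(o,v)-1$ from $o$ and other neighbors $v'_1,\dots,v'_k$, move to each $v_i$ with probability $\frac{\lambda}{\lambda j+k}$ and to each $v'_i$ with probability $\frac{1}{\lambda j+k}$. The $\lambda$-stationary random walk on $H\wr G$ with switch measure $\mu$ is $R_n=((L_n(g))_g,Z_n)$ with $Z_n$ the $\lambda$-homesick walk, $L_0\equiv\mathrm{id}_H$, $(U_n),(V_n)$ i.i.d. $\mu$-distributed independent of $(Z_n)$, and $L_{n+1}(g)=L_n(g)$ for $g\notin\{Z_n,Z_{n+1}\}$, $L_{n+1}(Z_n)=L_n(Z_n)U_{n+1}$, $L_{n+1}(Z_{n+1})=L_n(Z_{n+1})V_{n+1}$.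 Non-degenerate means the support of $\mu$ generates $H$. Transient means $R_n$ returns to the identity only finitely often almost surely. *)

theory Defs
  imports "HOL-Algebra.Algebra" "HOL-Probability.Probability"
begin

definition fin_gen_group :: "('g, 'b) monoid_scheme \<Rightarrow> bool" where
  "fin_gen_group G \<longleftrightarrow> group G \<and>
     (\<exists>S. finite S \<and> S \<subseteq> carrier G \<and> generate G S = carrier G)"

definition virtually_Z :: "('g, 'b) monoid_scheme \<Rightarrow> bool" where
  "virtually_Z G \<longleftrightarrow> (\<exists>K. subgroup K G \<and> finite (rcosets\<^bsub>G\<^esub> K) \<and>
                        G\<lparr>carrier := K\<rparr> \<cong> integer_group)"

text \<open>Graph distance in Cay(G,S) from the root (identity) to v: the least length of
  a word s_1 ... s_n over S with v = s_1 ... s_n (path 1, s_1, s_1 s_2, ...).\<close>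
definition word_dist :: "('g, 'b) monoid_scheme \<Rightarrow> 'g set \<Rightarrow> 'g \<Rightarrow> nat" where
  "word_dist G S v = (LEAST n. \<exists>ss. length ss = n \<and> set ss \<subseteq> S \<and>
                          v = foldr (\<lambda>s acc. s \<otimes>\<^bsub>G\<^esub> acc) ss \<one>\<^bsub>G\<^esub>)"

definition cay_nbrs :: "('g, 'b) monoid_scheme \<Rightarrow> 'g set \<Rightarrow> 'g \<Rightarrow> 'g set" where
  "cay_nbrs G S v = (\<lambda>s. v \<otimes>\<^bsub>G\<^esub> s) ` S"

definition closer_nbrs :: "('g, 'b) monoid_scheme \<Rightarrow> 'g set \<Rightarrow> 'g \<Rightarrow> 'g set" where
  "closer_nbrs G S v = {w \<in> cay_nbrs G S v. word_dist G S w + 1 = word_dist G S v}"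

definition homesick_trans :: "('g, 'b) monoid_scheme \<Rightarrow> 'g set \<Rightarrow> real \<Rightarrow> 'g \<Rightarrow> 'g \<Rightarrow> real" where
  "homesick_trans G S lam v w =
     (if w \<in> cay_nbrs G S v then
        (if w \<in> closer_nbrs G S v then lam else 1) /
        (lam * real (card (closer_nbrs G S v)) +
         real (card (cay_nbrs G S v - closer_nbrs G S v)))
      else 0)"

fun lamps :: "('h, 'c) monoid_scheme \<Rightarrow> (nat \<Rightarrow> 'a \<Rightarrow> 'g) \<Rightarrow> (nat \<Rightarrow> 'a \<Rightarrow> 'h) \<Rightarrow>
              (nat \<Rightarrow> 'a \<Rightarrow> 'h) \<Rightarrow> nat \<Rightarrow> 'a \<Rightarrow> 'g \<Rightarrow> 'h" where
  "lamps H Z U V 0 \<omega> = (\<lambda>g. \<one>\<^bsub>H\<^esub>)"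
| "lamps H Z U V (Suc n) \<omega> =
     (let L = lamps H Z U V n \<omega>;
          L' = L(Z n \<omega> := L (Z n \<omega>) \<otimes>\<^bsub>H\<^esub> U (Suc n) \<omega>)
      in L'(Z (Suc n) \<omega> := L' (Z (Suc n) \<omega>) \<otimes>\<^bsub>H\<^esub> V (Suc n) \<omega>))"

text \<open>The lam-stationary walk R_n = (L_n, Z_n) with switch measure mu, realised on a
  probability space M: Z is the homesick walk started at the identity, and
  (U_n)_{n\<ge>1}, (V_n)_{n\<ge>1} are i.i.d. mu, independent of Z. This is expressed by the
  joint finite-dimensional distributions (all values are discrete).\<close>
definition lamplighter_process ::
  "'a measure \<Rightarrow> ('g, 'b) monoid_scheme \<Rightarrow> 'g set \<Rightarrow> real \<Rightarrow> 'h pmf \<Rightarrow>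
   (nat \<Rightarrow> 'a \<Rightarrow> 'g) \<Rightarrow> (nat \<Rightarrow> 'a \<Rightarrow> 'h) \<Rightarrow> (nat \<Rightarrow> 'a \<Rightarrow> 'h) \<Rightarrow> bool" where
  "lamplighter_process M G S lam \<mu> Z U V \<longleftrightarrow>
     prob_space M \<and>
     (\<forall>n. Z n \<in> measurable M (count_space UNIV) \<and>
          U n \<in> measurable M (count_space UNIV) \<and>
          V n \<in> measurable M (count_space UNIV)) \<and>
     (\<forall>n z u v. measure M {\<omega> \<in> space M. \<forall>i\<le>n. Z i \<omega> = z i \<and>
                              (0 < i \<longrightarrow> U i \<omega> = u i \<and> V i \<omega> = v i)} =
        (if z 0 = \<one>\<^bsub>G\<^esub> then (\<Prod>i<n. homesick_trans G S lam (z i) (z (Suc i))) else 0) *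
        (\<Prod>i\<in>{1..n}. pmf \<mu> (u i) * pmf \<mu> (v i)))"

definition lamplighter_transient ::
  "'a measure \<Rightarrow> ('g, 'b) monoid_scheme \<Rightarrow> ('h, 'c) monoid_scheme \<Rightarrow>
   (nat \<Rightarrow> 'a \<Rightarrow> 'g) \<Rightarrow> (nat \<Rightarrow> 'a \<Rightarrow> 'h) \<Rightarrow> (nat \<Rightarrow> 'a \<Rightarrow> 'h) \<Rightarrow> bool" where
  "lamplighter_transient M G H Z U V \<longleftrightarrow>
     (AE \<omega> in M. finite {n. Z n \<omega> = \<one>\<^bsub>G\<^esub> \<and>
                            (\<forall>g\<in>carrier G. lamps H Z U V n \<omega> g = \<one>\<^bsub>H\<^esub>)})"

end

theory Submission
  imports Defs
begin

text \<open>
  Given the base path, the lamps are independent random walks on \<open>H\<close>, so the walk is back at the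
  identity with conditional probability at most \<open>q\<close> to the number of sites visited more than \<open>m\<close>
  times, if a lamp switched more than \<open>m\<close> times is off with probability at most \<open>q\<close>. Let \<open>w\<close> be a
  site closest to the root that has been visited at most \<open>m\<close> times, and \<open>r\<close> its distance: all sites
  of the open ball of radius \<open>r\<close> contribute a factor \<open>q\<close>, while every transition along an edge has
  probability at least \<open>\<delta> = 1 / (\<lambda> |S|)\<close>, so that the root is visited on average at most
  \<open>(m + 1) ((r + 1) \<delta>\<^sup>-\<^sup>r + 1)\<close> times before \<open>w\<close> has been visited more than \<open>m\<close> times. Summing over
  \<open>w\<close>, the expected number of returns is finite as soon as \<open>q\<close> to the size of the ball beats a fixed
  exponential in \<open>r\<close>. If \<open>H\<close> is infinite, \<open>q\<close> can be taken arbitrarily small and the trivial linear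
  lower bound on balls suffices. If \<open>H\<close> is finite, \<open>q = 1 / |H|\<close> and superlinear growth of \<open>G\<close> is
  needed: linear growth along a subsequence forces an element of infinite order (a pigeonhole argument
  on shortlex normal forms), and then either the cyclic group it generates has finite index or its
  cosets give quadratic growth.
\<close>

section \<open>Words and shortlex normal forms\<close>

text \<open>The fold that \<open>word_dist\<close> minimises over, named so that words can be
  concatenated and factored.\<close>

definition word_prod :: "('g, 'b) monoid_scheme \<Rightarrow> 'g list \<Rightarrow> 'g" where
  "word_prod G ss = foldr (\<lambda>s acc. s \<otimes>\<^bsub>G\<^esub> acc) ss \<one>\<^bsub>G\<^esub>"

lemma word_prod_Nil [simp]: "word_prod G [] = \<one>\<^bsub>G\<^esub>"
  and word_prod_Cons [simp]: "word_prod G (s # ss) = s \<otimes>\<^bsub>G\<^esub> word_prod G ss"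
  by (simp_all add: word_prod_def)

text \<open>Agreement with the shift by \<open>p\<close> lets blocks of length \<open>p\<close> be
  peeled off one at a time; \<open>t * p \<le> n\<close> keeps every comparison within the
  \<open>n\<close> letters where the agreement is known.\<close>

lemma take_periodic:
  assumes "take n y = take n (drop p y)" "t * p \<le> n"
  shows "take (t * p) y = concat (replicate t (take p y))"
  using assms(2)
proof (induction t)
  case (Suc t)
  have "take (Suc t * p) y = take p y @ take (t * p) (drop p y)"
    by (simp add: take_add add.commute)
  also have "take (t * p) (drop p y) = take (t * p) (take n (drop p y))"
    using Suc.prems by (simp add: min_def)
  also have "\<dots> = take (t * p) y"
    using Suc.prems by (simp add: assms(1)[symmetric] min_def)
  finally show ?case using Suc by simp
qed simp

context group
begin

lemma word_prod_closed [simp]: "set ss \<subseteq> carrier G \<Longrightarrow> word_prod G ss \<in> carrier G"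
  by (induction ss) auto

lemma word_prod_append:
  "set ss \<subseteq> carrier G \<Longrightarrow> set ts \<subseteq> carrier G \<Longrightarrow>
    word_prod G (ss @ ts) = word_prod G ss \<otimes> word_prod G ts"
  by (induction ss) (auto simp: m_assoc)

lemma word_prod_concat_replicate:
  "set ss \<subseteq> carrier G \<Longrightarrow> word_prod G (concat (replicate n ss)) = word_prod G ss [^] n"
proof (induction n)
  case (Suc n)
  have "set (concat (replicate n ss)) \<subseteq> carrier G"
    using Suc.prems by auto
  then show ?case
    using Suc nat_pow_Suc2[of "word_prod G ss" n] by (simp add: word_prod_append)
qed simp

end

text \<open>Separate from the Cayley graph of \<open>G\<close> because it is also applied to
  \<open>H\<close> with the support of \<open>\<mu>\<close>, in
  \<open>ex_many_words\<close>.\<close>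

locale symmetric_generators = group G for G (structure) +
  fixes S
  assumes gens_carrier: "S \<subseteq> carrier G"
    and gens_inv: "s \<in> S \<Longrightarrow> inv s \<in> S"
    and gens_generate: "generate G S = carrier G"
begin

lemma ex_word: "x \<in> carrier G \<Longrightarrow> \<exists>ss. set ss \<subseteq> S \<and> word_prod G ss = x"
proof -
  have "x \<in> generate G S \<Longrightarrow> \<exists>ss. set ss \<subseteq> S \<and> word_prod G ss = x"
  proof (induction rule: generate.induct)
    case one
    show ?case by (rule exI[of _ "[]"]) simp
  next
    case (incl h)
    then show ?case using gens_carrier by (intro exI[of _ "[h]"]) auto
  next
    case (inv h)
    then show ?case using gens_carrier gens_inv by (intro exI[of _ "[inv h]"]) auto
  next
    case (eng h1 h2)
    then obtain ss ts where "set ss \<subseteq> S" "word_prod G ss = h1" "set ts \<subseteq> S" "word_prod G ts = h2"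
      by blast
    then show ?case
      using gens_carrier by (intro exI[of _ "ss @ ts"]) (auto simp: word_prod_append)
  qed
  then show "x \<in> carrier G \<Longrightarrow> ?thesis" by (simp add: gens_generate)
qed

lemma word_closed: "set ss \<subseteq> S \<Longrightarrow> word_prod G ss \<in> carrier G"
  using gens_carrier by auto

end

locale infinite_cayley_graph = symmetric_generators +
  assumes finite_gens: "finite S" and infinite_carrier: "infinite (carrier G)"
begin

abbreviation len :: "'a \<Rightarrow> nat" where "len \<equiv> word_dist G S"

lemma len_le: "set ss \<subseteq> S \<Longrightarrow> len (word_prod G ss) \<le> length ss"
  unfolding word_dist_def word_prod_def by (intro Least_le) auto

lemma len_word: "x \<in> carrier G \<Longrightarrow> \<exists>ss. length ss = len x \<and> set ss \<subseteq> S \<and> word_prod G ss = x"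
proof -
  assume "x \<in> carrier G"
  then obtain ts where "set ts \<subseteq> S" "word_prod G ts = x" using ex_word by blast
  then have "\<exists>ss. length ss = length ts \<and> set ss \<subseteq> S \<and> x = foldr (\<lambda>s acc. s \<otimes> acc) ss \<one>"
    by (auto simp: word_prod_def)
  from LeastI[of "\<lambda>n. \<exists>ss. length ss = n \<and> set ss \<subseteq> S \<and> x = foldr (\<lambda>s acc. s \<otimes> acc) ss \<one>", OF this]
  show ?thesis by (auto simp: word_dist_def word_prod_def)
qed

lemma len_mult: "x \<in> carrier G \<Longrightarrow> y \<in> carrier G \<Longrightarrow> len (x \<otimes> y) \<le> len x + len y"
proof -
  assume "x \<in> carrier G" "y \<in> carrier G"
  then obtain ss ts where "length ss = len x" "set ss \<subseteq> S" "word_prod G ss = x"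
    "length ts = len y" "set ts \<subseteq> S" "word_prod G ts = y" by (metis len_word)
  then show ?thesis
    using len_le[of "ss @ ts"] gens_carrier by (simp add: word_prod_append subset_trans[OF _ gens_carrier])
qed

lemma len_one [simp]: "len \<one> = 0"
  using len_le[of "[]"] by simp

lemma len_pow: "x \<in> carrier G \<Longrightarrow> len (x [^] (n::nat)) \<le> n * len x"
proof (induction n)
  case (Suc n)
  then show ?case using len_mult[of "x [^] n" x] by simp
qed simp

section \<open>Balls and spheres of the word metric\<close>

definition word_ball :: "nat \<Rightarrow> 'a set" where "word_ball n = {x \<in> carrier G. len x \<le> n}"
definition word_sphere :: "nat \<Rightarrow> 'a set" where "word_sphere n = {x \<in> carrier G. len x = n}"

lemma finite_words: "finite {ss. set ss \<subseteq> S \<and> length ss \<le> n}"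
  using finite_lists_length_le[OF finite_gens] .

lemma finite_ball: "finite (word_ball n)"
proof (rule finite_subset)
  show "word_ball n \<subseteq> word_prod G ` {ss. set ss \<subseteq> S \<and> length ss \<le> n}"
    unfolding word_ball_def using len_word by force
qed (simp add: finite_words)

lemma sphere_subset_ball: "word_sphere n \<subseteq> word_ball n"
  by (auto simp: word_sphere_def word_ball_def)

lemma finite_sphere: "finite (word_sphere n)"
  using finite_ball sphere_subset_ball finite_subset by blast

lemma card_sphere_le: "card (word_sphere n) \<le> card S ^ n"
proof -
  have "word_sphere n \<subseteq> word_prod G ` {ss. set ss \<subseteq> S \<and> length ss = n}"
    unfolding word_sphere_def using len_word by force
  then have "card (word_sphere n) \<le> card {ss. set ss \<subseteq> S \<and> length ss = n}"
    using surj_card_le finite_gens finite_lists_length_eq by metis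
  then show ?thesis by (simp add: card_lists_length_eq finite_gens)
qed

text \<open>Some element lies outside the ball of radius \<open>n\<close>; by the triangle
  inequality the prefix of length \<open>n\<close> of a geodesic word for it is itself
  geodesic.\<close>

lemma sphere_nonempty: "word_sphere n \<noteq> {}"
proof -
  obtain x where x: "x \<in> carrier G" "x \<notin> word_ball n"
    using infinite_carrier finite_ball[of n] by (metis finite_subset subsetI)
  then obtain ss where ss: "length ss = len x" "set ss \<subseteq> S" "word_prod G ss = x"
    using len_word by blast
  have n: "n < len x" using x by (auto simp: word_ball_def)
  have t: "set (take n ss) \<subseteq> S" and d: "set (drop n ss) \<subseteq> S"
    using ss(2) set_take_subset[of n ss] set_drop_subset[of n ss] by auto
  have "x = word_prod G (take n ss) \<otimes> word_prod G (drop n ss)"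
    using ss t d gens_carrier by (metis append_take_drop_id subset_trans word_prod_append)
  then have "len x \<le> len (word_prod G (take n ss)) + len (word_prod G (drop n ss))"
    using t d len_mult word_closed by metis
  moreover have "len (word_prod G (take n ss)) \<le> n" "len (word_prod G (drop n ss)) \<le> len x - n"
    using len_le[OF t] len_le[OF d] ss n by auto
  ultimately have "len (word_prod G (take n ss)) = n" using n by linarith
  then show ?thesis using word_closed[OF t] by (auto simp: word_sphere_def)
qed

lemma ball_Suc: "word_ball (Suc n) = word_ball n \<union> word_sphere (Suc n)"
  by (auto simp: word_ball_def word_sphere_def)

lemma card_ball_Suc: "card (word_ball (Suc n)) = card (word_ball n) + card (word_sphere (Suc n))"
  unfolding ball_Suc by (rule card_Un_disjoint) (auto simp: finite_ball finite_sphere, auto simp: word_ball_def word_sphere_def)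

lemma card_sphere_pos: "0 < card (word_sphere n)"
  using sphere_nonempty finite_sphere by (simp add: card_gt_0_iff)

lemma card_ball_gt: "n < card (word_ball n)"
proof (induction n)
  case 0
  have "\<one> \<in> word_ball 0" by (simp add: word_ball_def)
  then show ?case using finite_ball[of 0] card_gt_0_iff by blast
next
  case (Suc n)
  then show ?case using card_sphere_pos[of "Suc n"] by (simp add: card_ball_Suc)
qed

section \<open>Shortlex normal forms and elements of infinite order\<close>

definition shortlex :: "('a \<times> 'a) set \<Rightarrow> 'a list \<Rightarrow> bool" where
  "shortlex r ss \<longleftrightarrow> set ss \<subseteq> S \<and>
     (\<forall>ts. set ts \<subseteq> S \<longrightarrow> word_prod G ts = word_prod G ss \<longrightarrow> (ts, ss) \<notin> lenlex r)"

text \<open>A smaller word for the middle factor would, put in its place, give a smaller word for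
  the whole product. Irreflexivity of \<open>r\<close> is what lets \<open>lenlex\<close> ignore the
  common prefix.\<close>

lemma shortlex_factor:
  assumes "irrefl r" "shortlex r (us @ vs @ ws)"
  shows "shortlex r vs"
  unfolding shortlex_def
proof (intro conjI allI impI notI)
  show "set vs \<subseteq> S" using assms by (auto simp: shortlex_def)
  fix ts assume ts: "set ts \<subseteq> S" "word_prod G ts = word_prod G vs" "(ts, vs) \<in> lenlex r"
  have sub: "set us \<subseteq> S" "set vs \<subseteq> S" "set ws \<subseteq> S"
    using assms by (auto simp: shortlex_def)
  then have "word_prod G (us @ ts @ ws) = word_prod G (us @ vs @ ws)"
    using ts gens_carrier by (simp add: word_prod_append subset_trans[OF _ gens_carrier])
  moreover have "(us @ ts @ ws, us @ vs @ ws) \<in> lenlex r"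
    using ts(3) assms(1) by (simp add: lenlex_append1)
  moreover have "set (us @ ts @ ws) \<subseteq> S" using sub ts by auto
  ultimately show False using assms(2) unfolding shortlex_def by blast
qed

text \<open>\<open>lenlex\<close> compares lengths first, so normal forms are geodesic.\<close>

lemma shortlex_length:
  assumes "shortlex r ss"
  shows "length ss = len (word_prod G ss)"
proof -
  have "set ss \<subseteq> S" using assms by (simp add: shortlex_def)
  then obtain ts where ts: "length ts = len (word_prod G ss)" "set ts \<subseteq> S"
      "word_prod G ts = word_prod G ss"
    using len_word[OF word_closed] by blast
  then have "(ts, ss) \<notin> lenlex r" using assms by (simp add: shortlex_def)
  then have "length ss \<le> length ts" by (simp add: lenlex_conv)
  then show ?thesis using ts(1) len_le \<open>set ss \<subseteq> S\<close> by (metis le_antisym)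
qed

lemma shortlex_inj:
  assumes "total r" "shortlex r ss" "shortlex r ts" "word_prod G ss = word_prod G ts"
  shows "ss = ts"
  using assms total_lenlex[OF assms(1)] unfolding shortlex_def total_on_def
  by (metis UNIV_I)

lemma ex_shortlex:
  assumes "wf r" "x \<in> carrier G"
  shows "\<exists>ss. shortlex r ss \<and> word_prod G ss = x"
proof -
  obtain ss where "set ss \<subseteq> S" "word_prod G ss = x" using ex_word assms(2) by blast
  then obtain ts where "ts \<in> {ss. set ss \<subseteq> S \<and> word_prod G ss = x}"
    "\<And>us. (us, ts) \<in> lenlex r \<Longrightarrow> us \<notin> {ss. set ss \<subseteq> S \<and> word_prod G ss = x}"
    using wfE_min[OF wf_lenlex[OF assms(1)], of ss "{ss. set ss \<subseteq> S \<and> word_prod G ss = x}"] by blast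
  then show ?thesis by (auto simp: shortlex_def)
qed

text \<open>A shortlex word of length \<open>n + K\<close> has \<open>K + 1\<close> factors of length \<open>n\<close>, and factors of shortlex
  words are shortlex; if at most \<open>K\<close> elements have length \<open>n\<close>, two of these factors coincide, so
  the word is periodic on a stretch of length \<open>n\<close>.\<close>

lemma shortlex_power:
  assumes r: "wf r" "total r" and K: "card (word_sphere n) \<le> K" and t: "t * K \<le> n"
  shows "\<exists>w. w \<noteq> [] \<and> length w \<le> K \<and> shortlex r (concat (replicate t w))"
proof -
  have irr: "irrefl r" using r(1) by (simp add: wf_irrefl irrefl_def)
  obtain g where g: "g \<in> carrier G" "len g = n + K"
    using sphere_nonempty[of "n + K"] by (auto simp: word_sphere_def)
  obtain x where x: "shortlex r x" "word_prod G x = g" using ex_shortlex[OF r(1) g(1)] by blast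
  have lx: "length x = n + K" using shortlex_length[OF x(1)] x(2) g by simp
  define f where "f i = word_prod G (take n (drop i x))" for i
  have sl: "shortlex r (take n (drop i x))" for i
    using shortlex_factor[OF irr, of "take i x" "take n (drop i x)" "drop n (drop i x)"] x(1)
    by (simp only: append_take_drop_id)
  have "f ` {0..K} \<subseteq> word_sphere n"
  proof
    fix h assume "h \<in> f ` {0..K}"
    then obtain i where i: "i \<le> K" "h = f i" by auto
    have "set (take n (drop i x)) \<subseteq> S" using sl by (simp add: shortlex_def)
    then show "h \<in> word_sphere n"
      using shortlex_length[OF sl[of i]] i lx word_closed by (simp add: word_sphere_def f_def)
  qed
  then have "card (f ` {0..K}) \<le> K" using card_mono[OF finite_sphere] K le_trans by blast
  then have "\<not> inj_on f {0..K}" using card_image[of f "{0..K}"] by auto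
  then obtain i j where ij: "i \<le> K" "j \<le> K" "i < j" "f i = f j"
    unfolding inj_on_def by (metis atLeastAtMost_iff nat_neq_iff)
  define p where "p = j - i"
  define y where "y = drop i x"
  have "take n (drop i x) = take n (drop j x)"
    using shortlex_inj[OF r(2) sl sl] ij(4) by (simp add: f_def)
  then have per: "take n y = take n (drop p y)" using ij by (simp add: y_def p_def)
  have p: "0 < p" "p \<le> K" using ij by (auto simp: p_def)
  have "t * p \<le> n" using p(2) t by (meson le_trans mult_le_mono2)
  then have eq: "take (t * p) y = concat (replicate t (take p y))" by (rule take_periodic[OF per])
  have "shortlex r (take (t * p) y)"
    using shortlex_factor[OF irr, of "take i x" "take (t * p) y" "drop (t * p) y"] x(1)
    by (simp only: y_def append_take_drop_id)
  moreover have "y \<noteq> []" using ij lx by (auto simp: y_def)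
  ultimately show ?thesis using p eq by (intro exI[of _ "take p y"]) auto
qed

text \<open>In a torsion group the finitely many words of length at most \<open>K\<close> have
  values of bounded order. The high power of a short word supplied by \<open>shortlex_power\<close>
  then contains a nonempty shortlex factor with value \<one>, although the normal form of \<one> is
  empty.\<close>

lemma ex_infinite_order:
  assumes inf: "\<exists>\<^sub>\<infinity>n. card (word_sphere n) \<le> K"
  shows "\<exists>g\<in>carrier G. \<forall>e::nat. 0 < e \<longrightarrow> g [^] e \<noteq> \<one>"
proof (rule ccontr)
  assume "\<not> ?thesis"
  then have "\<forall>g\<in>carrier G. \<exists>e::nat. 0 < e \<and> g [^] e = \<one>" by blast
  then obtain e :: "'a \<Rightarrow> nat" where e: "\<And>g. g \<in> carrier G \<Longrightarrow> 0 < e g \<and> g [^] e g = \<one>" by metis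
  define W where "W = {ss. set ss \<subseteq> S \<and> length ss \<le> K}"
  define T where "T = Max (insert 0 ((\<lambda>w. e (word_prod G w)) ` W))"
  have T: "e (word_prod G w) \<le> T" if "w \<in> W" for w
    using that finite_words[of K] unfolding T_def W_def by (intro Max_ge) auto
  obtain r :: "('a \<times> 'a) set" where "well_order_on UNIV r" using well_order_on by blast
  \<comment> \<open>\<open>well_order_on\<close> gives a reflexive order; its strict part is
    well-founded and irreflexive.\<close>
  define r' where "r' = r - Id"
  have r: "wf r'" "total r'"
    using \<open>well_order_on UNIV r\<close>
    by (auto simp: r'_def well_order_on_def linear_order_on_def total_on_def)
  have irr: "irrefl r'" by (simp add: r'_def irrefl_def)
  \<comment> \<open>A stretch of length \<open>n\<close> has room for \<open>Suc T\<close> periods,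
    each of length at most \<open>K\<close>.\<close>
  obtain n where n: "n > Suc T * K" "card (word_sphere n) \<le> K"
    using inf unfolding INFM_nat by blast
  obtain w where w: "w \<noteq> []" "length w \<le> K" "shortlex r' (concat (replicate (Suc T) w))"
    using shortlex_power[OF r n(2), of "Suc T"] n(1) by auto
  have wS: "set w \<subseteq> S" using w(3) by (auto simp: shortlex_def)
  define g where "g = word_prod G w"
  have g: "g \<in> carrier G" using word_closed[OF wS] by (simp add: g_def)
  have "e g \<le> Suc T" using T[of w] w(2) wS by (simp add: W_def g_def)
  then have "replicate (Suc T) w = replicate (e g) w @ replicate (Suc T - e g) w"
    by (simp add: replicate_add[symmetric] del: replicate_Suc)
  then have "shortlex r' ([] @ concat (replicate (e g) w) @ concat (replicate (Suc T - e g) w))"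
    using w(3) by (metis append_Nil concat_append)
  then have sl: "shortlex r' (concat (replicate (e g) w))" by (rule shortlex_factor[OF irr])
  have "word_prod G (concat (replicate (e g) w)) = \<one>"
    using word_prod_concat_replicate[of w "e g"] wS gens_carrier e[OF g] by (simp add: g_def subset_trans)
  then have "concat (replicate (e g) w) = []" using shortlex_length[OF sl] by simp
  then show False using e[OF g] w(1) by (cases "e g") auto
qed

end

section \<open>Superlinear growth\<close>

text \<open>If this subgroup had finite index, the group would be virtually-Z by definition; this is
  how the hypothesis on \<open>G\<close> enters.\<close>

lemma (in group) range_int_pow_iso:
  assumes g: "g \<in> carrier G" and inf: "\<And>e::nat. 0 < e \<Longrightarrow> g [^] e \<noteq> \<one>"
  shows "subgroup (range (\<lambda>k::int. g [^] k)) G"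
    and "G\<lparr>carrier := range (\<lambda>k::int. g [^] k)\<rparr> \<cong> integer_group"
proof -
  show sub: "subgroup (range (\<lambda>k::int. g [^] k)) G"
  proof
    fix x assume "x \<in> range (\<lambda>k::int. g [^] k)"
    then obtain k :: int where "x = g [^] k" by blast
    then have "inv x = g [^] (- k)" using g by (simp add: int_pow_neg)
    then show "inv x \<in> range (\<lambda>k::int. g [^] k)" by blast
  next
    fix x y assume "x \<in> range (\<lambda>k::int. g [^] k)" "y \<in> range (\<lambda>k::int. g [^] k)"
    then obtain k l :: int where "x = g [^] k" "y = g [^] l" by blast
    then have "x \<otimes> y = g [^] (k + l)" using g by (simp add: int_pow_mult)
    then show "x \<otimes> y \<in> range (\<lambda>k::int. g [^] k)" by blast
  next
    have "\<one> = g [^] (0::int)" by simp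
    then show "\<one> \<in> range (\<lambda>k::int. g [^] k)" by blast
  qed (use g in auto)
  have "inj (\<lambda>k::int. g [^] k)"
  proof (rule linorder_injI)
    fix k l :: int assume "k < l"
    show "g [^] k \<noteq> g [^] l"
    proof
      assume "g [^] k = g [^] l"
      then have "g [^] (l - k) = \<one>" using g by (simp add: int_pow_diff)
      moreover have "l - k = int (nat (l - k))" using \<open>k < l\<close> by simp
      ultimately have "g [^] nat (l - k) = \<one>" by (metis int_pow_int)
      then show False using inf[of "nat (l - k)"] \<open>k < l\<close> by simp
    qed
  qed
  then have "(\<lambda>k::int. g [^] k) \<in> iso integer_group (G\<lparr>carrier := range (\<lambda>k::int. g [^] k)\<rparr>)"
    using g by (auto simp: iso_def hom_def bij_betw_def int_pow_mult)
  then show "G\<lparr>carrier := range (\<lambda>k::int. g [^] k)\<rparr> \<cong> integer_group"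
    using group.iso_sym[OF group_integer_group] is_isoI by blast
qed

context infinite_cayley_graph
begin

lemma word_ball_mono: "m \<le> n \<Longrightarrow> word_ball m \<subseteq> word_ball n"
  by (auto simp: word_ball_def)

lemma word_ball_SucE:
  assumes "x \<in> word_ball (Suc n)"
  shows "x \<in> word_ball n \<or> (\<exists>y\<in>word_ball n. \<exists>s\<in>S. x = y \<otimes> s)"
proof (cases "x \<in> word_ball n")
  case False
  have x: "x \<in> carrier G" "len x = Suc n" using assms False by (auto simp: word_ball_def)
  then obtain ss where ss: "length ss = Suc n" "set ss \<subseteq> S" "word_prod G ss = x" using len_word by metis
  obtain ts s where ts: "ss = ts @ [s]" using ss(1) by (cases ss rule: rev_cases) auto
  have "word_prod G ts \<in> word_ball n" using len_le[of ts] word_closed[of ts] ss ts by (auto simp: word_ball_def)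
  moreover have "x = word_prod G ts \<otimes> s"
    using ss ts gens_carrier word_prod_append[of ts "[s]"] by auto
  ultimately show ?thesis using ss(2) ts by auto
qed simp

text \<open>The set of cosets met by the ball grows strictly with the radius. If two consecutive
  balls met the same cosets, right multiplication by generators would never produce a new one, and
  finitely many cosets would exhaust \<open>rcosets K\<close>.\<close>

lemma card_cosets_ball:
  assumes K: "subgroup K G" and inf: "infinite (rcosets K)"
  shows "n < card ((\<lambda>x. K #> x) ` word_ball n)"
proof -
  define C where "C n = (\<lambda>x. K #> x) ` word_ball n" for n
  have Kc: "K \<subseteq> carrier G" using K by (rule subgroup.subset)
  have fin: "finite (C n)" for n by (simp add: C_def finite_ball)
  have mono: "C n \<subseteq> C (Suc n)" for n using word_ball_mono[of n "Suc n"] by (auto simp: C_def)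
  have step: "C (Suc (Suc n)) \<subseteq> C (Suc n)" if "C (Suc n) \<subseteq> C n" for n
  proof
    fix c assume "c \<in> C (Suc (Suc n))"
    then obtain x where x: "x \<in> word_ball (Suc (Suc n))" "c = K #> x" by (auto simp: C_def)
    consider "x \<in> word_ball (Suc n)" | y s where "y \<in> word_ball (Suc n)" "s \<in> S" "x = y \<otimes> s"
      using word_ball_SucE[OF x(1)] by blast
    then show "c \<in> C (Suc n)"
    proof cases
      case 1
      then show ?thesis using x by (auto simp: C_def)
    next
      case 2
      \<comment> \<open>Replacing \<open>y\<close> by a representative of the same coset in the
        smaller ball leaves room for the factor \<open>s\<close>.\<close>
      have "K #> y \<in> C n" using 2 that by (auto simp: C_def)
      then obtain y' where y': "y' \<in> word_ball n" "K #> y = K #> y'" by (auto simp: C_def)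
      have car: "y \<in> carrier G" "y' \<in> carrier G" "s \<in> carrier G"
        using 2 y' gens_carrier by (auto simp: word_ball_def)
      have "len s \<le> 1" using len_le[of "[s]"] 2 car by simp
      then have "y' \<otimes> s \<in> word_ball (Suc n)"
        using len_mult[of y' s] car y' by (auto simp: word_ball_def)
      moreover have "c = K #> (y' \<otimes> s)"
        using x 2 y' car Kc by (metis coset_mult_assoc)
      ultimately show ?thesis by (auto simp: C_def)
    qed
  qed
  have strict: "C n \<subset> C (Suc n)" for n
  proof (rule ccontr)
    assume "\<not> C n \<subset> C (Suc n)"
    then have "C (Suc n) \<subseteq> C n" using mono by blast
    then have "C (Suc (n + k)) \<subseteq> C (n + k)" for k
      by (induction k) (use step in auto)
    then have sub: "C (n + k) \<subseteq> C n" for k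
    proof (induction k)
      case (Suc k)
      then show ?case by (metis add_Suc_right subset_trans)
    qed simp
    have "rcosets K \<subseteq> C n"
    proof
      fix c assume "c \<in> rcosets K"
      then obtain x where "x \<in> carrier G" "c = K #> x" by (auto simp: RCOSETS_def)
      then have "c \<in> C (n + len x)" by (auto simp: C_def word_ball_def)
      then show "c \<in> C n" using sub by blast
    qed
    then show False using inf fin finite_subset by blast
  qed
  have "n < card (C n)"
  proof (induction n)
    case 0
    have "\<one> \<in> word_ball 0" by (simp add: word_ball_def)
    then show ?case using fin[of 0] by (auto simp: C_def card_gt_0_iff)
  next
    case (Suc n)
    then show ?case using psubset_card_mono[OF fin strict[of n]] by linarith
  qed
  then show ?thesis by (simp add: C_def)
qed

text \<open>The ball of radius \<open>n\<close> meets more than \<open>n\<close> cosets of the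
  cyclic group. Choosing a representative of each there and multiplying it on the left by
  \<open>g [^] j\<close> for \<open>j \<le> n\<close> gives distinct elements: the coset determines
  the representative, and then the power determines \<open>j\<close>.\<close>

lemma quadratic_growth:
  assumes g: "g \<in> carrier G" and inf: "\<And>e::nat. 0 < e \<Longrightarrow> g [^] e \<noteq> \<one>"
    and cosets: "infinite (rcosets (range (\<lambda>k::int. g [^] k)))"
  shows "(n + 1) * (n + 1) \<le> card (word_ball (n * (len g + 1)))"
proof -
  define K where "K = range (\<lambda>k::int. g [^] k)"
  have K: "subgroup K G" unfolding K_def by (rule range_int_pow_iso[OF g inf])
  define C where "C = (\<lambda>x. K #> x) ` word_ball n"
  define \<rho> where "\<rho> = inv_into (word_ball n) (\<lambda>x. K #> x)"
  have \<rho>: "\<rho> c \<in> word_ball n" "K #> \<rho> c = c" if "c \<in> C" for c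
    using that inv_into_into[of c "\<lambda>x. K #> x" "word_ball n"] f_inv_into_f[of c "\<lambda>x. K #> x" "word_ball n"]
    unfolding C_def \<rho>_def by blast+
  have \<rho>c: "\<rho> c \<in> carrier G" if "c \<in> C" for c using \<rho>(1)[OF that] by (simp add: word_ball_def)
  define f where "f = (\<lambda>(j::nat, c). g [^] j \<otimes> \<rho> c)"
  have gK: "g [^] j \<in> K" for j :: nat unfolding K_def by (metis int_pow_int rangeI)
  have pow_inj: "j = k" if "g [^] j = g [^] k" for j k :: nat
  proof (rule ccontr)
    have *: "False" if "g [^] j = g [^] k" "j < k" for j k :: nat
    proof -
      have "g [^] k = g [^] j \<otimes> g [^] (k - j)" using that(2) nat_pow_mult[OF g, of j "k - j"] by simp
      then have "g [^] (k - j) = \<one>" using that g by (metis l_cancel_one' nat_pow_closed)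
      then show False using inf[of "k - j"] that by simp
    qed
    assume "j \<noteq> k"
    then show False using * that by (metis nat_neq_iff)
  qed
  have inj: "inj_on f ({..n} \<times> C)"
  proof (rule inj_onI, clarify)
    fix j k c d assume cd: "c \<in> C" "d \<in> C" and eq: "f (j, c) = f (k, d)"
    have "K #> f (i, e) = e" if "e \<in> C" for i e
    proof -
      have "K #> f (i, e) = (K #> g [^] i) #> \<rho> e"
        using g \<rho>c[OF that] subgroup.subset[OF K] by (simp add: f_def coset_mult_assoc)
      also have "K #> g [^] i = K" using K gK by (simp add: subgroup.rcos_const)
      finally show ?thesis using \<rho>[OF that] by simp
    qed
    then have "c = d" using cd eq by metis
    then have "g [^] j = g [^] k" using eq \<rho>c[OF cd(1)] g by (simp add: f_def)
    then show "j = k \<and> c = d" using pow_inj \<open>c = d\<close> by blast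
  qed
  have "f ` ({..n} \<times> C) \<subseteq> word_ball (n * (len g + 1))"
  proof
    fix h assume "h \<in> f ` ({..n} \<times> C)"
    then obtain j c where jc: "j \<in> {..n}" "c \<in> C" and h: "h = f (j, c)" by blast
    have "len (g [^] j \<otimes> \<rho> c) \<le> len (g [^] j) + len (\<rho> c)" using g \<rho>c[OF jc(2)] by (simp add: len_mult)
    also have "\<dots> \<le> j * len g + n" using len_pow[OF g, of j] \<rho>(1)[OF jc(2)] by (simp add: word_ball_def add_mono)
    also have "\<dots> \<le> n * (len g + 1)" using jc by simp
    finally show "h \<in> word_ball (n * (len g + 1))"
      using h g \<rho>c[OF jc(2)] by (simp add: f_def word_ball_def)
  qed
  then have "card ({..n} \<times> C) \<le> card (word_ball (n * (len g + 1)))"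
    using card_inj_on_le[OF inj _ finite_ball] by blast
  moreover have "n + 1 \<le> card C"
    using card_cosets_ball[OF K, of n] cosets by (simp add: K_def C_def)
  ultimately show ?thesis
    by (metis Suc_eq_plus1 card_atMost card_cartesian_product le_trans mult_le_mono2)
qed

lemma superlinear_growth:
  assumes "\<not> virtually_Z G"
  shows "\<exists>N. \<forall>n\<ge>N. c * n \<le> card (word_ball n)"
proof (rule ccontr)
  assume "\<not> ?thesis"
  then have lin: "\<exists>n\<ge>N. card (word_ball n) < c * n" for N by (meson not_le)
  \<comment> \<open>The factor 2 pays for the first \<open>m\<close> spheres: if all later ones were
    larger than \<open>2 * c\<close>, then for \<open>n \<ge> 2 * m\<close> the ball would have at
    least \<open>2 * c * (n - m) \<ge> c * n\<close> elements.\<close>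
  have "\<exists>\<^sub>\<infinity>n. card (word_sphere n) \<le> 2 * c"
  proof (rule ccontr)
    assume "\<not> ?thesis"
    then obtain m where m: "\<And>n. n > m \<Longrightarrow> 2 * c < card (word_sphere n)"
      by (auto simp: INFM_nat not_le)
    have *: "2 * c * k \<le> card (word_ball (m + k))" for k
    proof (induction k)
      case (Suc k)
      then show ?case using m[of "m + Suc k"] by (simp add: card_ball_Suc)
    qed simp
    obtain n where n: "n \<ge> 2 * m" "card (word_ball n) < c * n" using lin by blast
    then have "n \<le> 2 * (n - m)" by linarith
    then have "c * n \<le> 2 * c * (n - m)" by (metis mult.assoc mult.commute mult_le_mono2)
    also have "\<dots> \<le> card (word_ball n)" using *[of "n - m"] n by simp
    finally show False using n by simp
  qed
  then obtain g where g: "g \<in> carrier G" "\<And>e::nat. 0 < e \<Longrightarrow> g [^] e \<noteq> \<one>"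
    using ex_infinite_order by blast
  have "infinite (rcosets (range (\<lambda>k::int. g [^] k)))"
    using range_int_pow_iso[OF g] assms unfolding virtually_Z_def by blast
  note quad = quadratic_growth[OF g this]
  define L where "L = len g + 1"
  \<comment> \<open>With \<open>k = n div L\<close>, quadratic growth at scale \<open>k\<close>
    forces \<open>k + 1 < c * L\<close>, hence \<open>n < c * L * L\<close>; the choice of
    \<open>n\<close> excludes this.\<close>
  obtain n where n: "n \<ge> c * L * L" "card (word_ball n) < c * n" using lin by blast
  define k where "k = n div L"
  have nk: "n < (k + 1) * L"
    unfolding k_def by (metis L_def Suc_eq_plus1 dividend_less_div_times mult.commute mult_Suc_right zero_less_Suc)
  have "(k + 1) * (k + 1) \<le> card (word_ball (k * L))" using quad[of k] by (simp add: L_def)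
  also have "\<dots> \<le> card (word_ball n)"
    by (intro card_mono finite_ball word_ball_mono) (simp add: k_def)
  also have "\<dots> < c * n" by (fact n)
  also have "\<dots> \<le> c * ((k + 1) * L)" using nk by (simp del: mult_Suc)
  finally have "(k + 1) * (k + 1) < (c * L) * (k + 1)" by (simp only: mult_ac)
  then have "k + 1 < c * L" using mult_less_cancel2 by blast
  then have "(k + 1) * L < c * L * L" by (rule mult_less_mono1) (simp add: L_def)
  then show False using nk n by linarith
qed

end

section \<open>Expected visits in a uniformly elliptic chain\<close>

text \<open>What the visit estimates need from the homesick walk: finitely many neighbours and a
  uniform lower bound on the edge probabilities.\<close>

locale elliptic_chain =
  fixes nb :: "'g \<Rightarrow> 'g set" and P :: "'g \<Rightarrow> 'g \<Rightarrow> real" and \<delta> :: real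
  assumes finite_nb: "finite (nb x)"
    and P_sum: "(\<Sum>y\<in>nb x. P x y) = 1"
    and P_ge: "y \<in> nb x \<Longrightarrow> \<delta> \<le> P x y"
    and \<delta>_pos: "0 < \<delta>"
begin

lemma P_nonneg: "y \<in> nb x \<Longrightarrow> 0 \<le> P x y"
  using P_ge[of y x] \<delta>_pos by linarith

text \<open>Expectation over the first \<open>n\<close> steps as a finite sum, free of measure
  theory. Recursion on the first step suits first-step analysis; \<open>path_expect_eq_sum\<close>
  gives the form used for monotonicity and for comparison with cylinder probabilities.\<close>

primrec path_expect :: "nat \<Rightarrow> 'g \<Rightarrow> ('g list \<Rightarrow> real) \<Rightarrow> real" where
  "path_expect 0 x f = f [x]"
| "path_expect (Suc n) x f = (\<Sum>y\<in>nb x. P x y * path_expect n y (\<lambda>xs. f (x # xs)))"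

primrec paths :: "nat \<Rightarrow> 'g \<Rightarrow> 'g list set" where
  "paths 0 x = {[x]}"
| "paths (Suc n) x = (\<Union>y\<in>nb x. (#) x ` paths n y)"

definition path_weight :: "nat \<Rightarrow> 'g list \<Rightarrow> real" where
  "path_weight n xs = (\<Prod>i<n. P (xs ! i) (xs ! Suc i))"

lemma finite_paths [simp]: "finite (paths n x)"
  by (induction n arbitrary: x) (auto simp: finite_nb)

lemma pathsD: "xs \<in> paths n x \<Longrightarrow> length xs = Suc n \<and> xs ! 0 = x"
  by (induction n arbitrary: x xs) fastforce+

lemma path_expect_eq_sum: "path_expect n x f = (\<Sum>xs\<in>paths n x. path_weight n xs * f xs)"
proof (induction n arbitrary: x f)
  case 0
  show ?case by (simp add: path_weight_def)
next
  case (Suc n)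
  have "(\<Sum>xs\<in>paths (Suc n) x. path_weight (Suc n) xs * f xs)
      = (\<Sum>y\<in>nb x. \<Sum>xs\<in>(#) x ` paths n y. path_weight (Suc n) xs * f xs)"
    unfolding paths.simps by (rule sum.UNION_disjoint) (auto simp: finite_nb dest!: pathsD)
  also have "\<dots> = (\<Sum>y\<in>nb x. \<Sum>xs\<in>paths n y. path_weight (Suc n) (x # xs) * f (x # xs))"
    by (rule sum.cong[OF refl], subst sum.reindex) auto
  also have "\<dots> = (\<Sum>y\<in>nb x. \<Sum>xs\<in>paths n y. P x y * (path_weight n xs * f (x # xs)))"
    unfolding path_weight_def prod.lessThan_Suc_shift by (intro sum.cong refl) (auto dest: pathsD)
  also have "\<dots> = path_expect (Suc n) x f"
    by (simp add: Suc.IH sum_distrib_left)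
  finally show ?case by simp
qed

lemma path_weight_nonneg: "xs \<in> paths n x \<Longrightarrow> 0 \<le> path_weight n xs"
proof (induction n arbitrary: x xs)
  case (Suc n)
  then obtain y ys where y: "y \<in> nb x" "ys \<in> paths n y" "xs = x # ys" by auto
  then have "path_weight (Suc n) xs = P x y * path_weight n ys"
    unfolding path_weight_def prod.lessThan_Suc_shift by (auto dest: pathsD)
  then show ?case using Suc.IH[OF y(2)] P_nonneg[OF y(1)] by simp
qed (simp add: path_weight_def)

lemma path_expect_mono:
  "(\<And>xs. xs \<in> paths n x \<Longrightarrow> f xs \<le> g xs) \<Longrightarrow> path_expect n x f \<le> path_expect n x g"
  unfolding path_expect_eq_sum by (intro sum_mono mult_left_mono path_weight_nonneg)

lemma path_expect_cong:
  "(\<And>xs. xs \<in> paths n x \<Longrightarrow> f xs = g xs) \<Longrightarrow> path_expect n x f = path_expect n x g"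
  unfolding path_expect_eq_sum by simp

lemma path_expect_sum:
  "path_expect n x (\<lambda>xs. \<Sum>i\<in>I. c i * f i xs) = (\<Sum>i\<in>I. c i * path_expect n x (f i))"
  unfolding path_expect_eq_sum sum_distrib_left
  by (subst sum.swap) (simp add: mult_ac)

lemma path_expect_0: "path_expect n x (\<lambda>_. 0) = 0"
  unfolding path_expect_eq_sum by simp

lemma path_expect_1: "path_expect n x (\<lambda>_. 1) = 1"
  by (induction n arbitrary: x) (simp_all add: P_sum)

text \<open>Expected number of times before \<open>N\<close> at which the chain started in \<open>x\<close> is at \<open>z\<close> having seen \<open>w\<close>
  at most \<open>m\<close> times strictly earlier.\<close>

definition green :: "'g \<Rightarrow> 'g \<Rightarrow> nat \<Rightarrow> nat \<Rightarrow> 'g \<Rightarrow> real" where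
  "green z w m N x =
     (\<Sum>n<N. path_expect n x (\<lambda>xs. of_bool (last xs = z \<and> count_list (butlast xs) w \<le> m)))"

lemma green_0: "green z w m 0 x = 0"
  by (simp add: green_def)

text \<open>First-step analysis. A start in \<open>w\<close> uses up one of the \<open>m\<close>
  allowed earlier visits; for \<open>m = 0\<close> it kills all later contributions, while time 0
  itself still counts.\<close>

lemma green_Suc:
  "green z w m (Suc N) x = of_bool (x = z) +
     (if x = w \<and> m = 0 then 0
      else \<Sum>y\<in>nb x. P x y * green z w (if x = w then m - 1 else m) N y)"
proof -
  define \<phi> where "\<phi> m xs = (of_bool (last xs = z \<and> count_list (butlast xs) w \<le> m) :: real)" for m xs
  have G: "green z w m N x = (\<Sum>n<N. path_expect n x (\<phi> m))" for m N x
    by (simp add: green_def \<phi>_def[abs_def])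
  have shift: "path_expect n y (\<lambda>xs. \<phi> m (x # xs)) =
      (if x = w \<and> m = 0 then 0 else path_expect n y (\<phi> (if x = w then m - 1 else m)))" for n y
  proof -
    have "path_expect n y (\<lambda>xs. \<phi> m (x # xs)) =
        path_expect n y (\<lambda>xs. if x = w \<and> m = 0 then 0 else \<phi> (if x = w then m - 1 else m) xs)"
      by (rule path_expect_cong) (use pathsD in \<open>force simp: \<phi>_def\<close>)
    then show ?thesis by (auto simp: path_expect_0)
  qed
  have "green z w m (Suc N) x = \<phi> m [x] + (\<Sum>n<N. \<Sum>y\<in>nb x. P x y * path_expect n y (\<lambda>xs. \<phi> m (x # xs)))"
    unfolding G sum.lessThan_Suc_shift by simp
  also have "(\<Sum>n<N. \<Sum>y\<in>nb x. P x y * path_expect n y (\<lambda>xs. \<phi> m (x # xs))) =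
      (if x = w \<and> m = 0 then 0
      else \<Sum>y\<in>nb x. P x y * green z w (if x = w then m - 1 else m) N y)"
    unfolding shift G sum_distrib_left by (subst sum.swap) auto
  finally show ?thesis by (simp add: \<phi>_def)
qed

lemma green_nonneg: "0 \<le> green z w m N x"
  unfolding green_def path_expect_eq_sum by (intro sum_nonneg mult_nonneg_nonneg path_weight_nonneg) auto

lemma green_mono: "N \<le> N' \<Longrightarrow> green z w m N x \<le> green z w m N' x"
  unfolding green_def path_expect_eq_sum
  by (intro sum_mono2) (auto intro!: sum_nonneg mult_nonneg_nonneg path_weight_nonneg)

lemma P_average_le:
  assumes "\<And>y. y \<in> nb x \<Longrightarrow> f y \<le> c"
  shows "(\<Sum>y\<in>nb x. P x y * f y) \<le> c"
proof -
  have "(\<Sum>y\<in>nb x. P x y * f y) \<le> (\<Sum>y\<in>nb x. P x y * c)"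
    using assms P_nonneg by (intro sum_mono mult_left_mono) auto
  also have "\<dots> = c" by (simp add: P_sum flip: sum_distrib_right)
  finally show ?thesis .
qed

text \<open>The neighbour \<open>y0\<close> carries weight at least \<delta>, and moving weight
  beyond that from the others to \<open>y0\<close> can only lower the bound, since
  \<open>f y0 \<le> c\<close>.\<close>

lemma P_average_le':
  assumes "\<And>y. y \<in> nb x \<Longrightarrow> f y \<le> c" "y0 \<in> nb x"
  shows "(\<Sum>y\<in>nb x. P x y * f y) \<le> (1 - \<delta>) * c + \<delta> * f y0"
proof -
  have "\<delta> * (c - f y0) \<le> P x y0 * (c - f y0)"
    using P_ge[OF assms(2)] assms by (intro mult_right_mono) auto
  also have "\<dots> \<le> (\<Sum>y\<in>nb x. P x y * (c - f y))"
    using assms P_nonneg by (intro member_le_sum) (auto simp: finite_nb)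
  also have "\<dots> = c - (\<Sum>y\<in>nb x. P x y * f y)"
    by (simp add: right_diff_distrib sum_subtractf P_sum flip: sum_distrib_right)
  finally show ?thesis by (simp add: algebra_simps)
qed

text \<open>A maximum principle: nothing is counted before \<open>z\<close> is reached, and the time
  spent on the way only shortens the horizon.\<close>

lemma green_le_diagonal: "green z w 0 N x \<le> green z w 0 N z"
proof (induction N arbitrary: x)
  case 0
  show ?case by (simp add: green_0)
next
  case (Suc N)
  show ?case
  proof (cases "x = z")
    case False
    have "green z w 0 (Suc N) x \<le> green z w 0 N z"
      using False Suc.IH P_average_le[of x "green z w 0 N" "green z w 0 N z"] green_nonneg
      by (auto simp: green_Suc)
    then show ?thesis using green_mono[of N "Suc N" z w 0 z] by linarith
  qed simp
qed

inductive reaches :: "'g \<Rightarrow> nat \<Rightarrow> 'g \<Rightarrow> bool" for w where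
  refl: "reaches w 0 w"
| step: "y \<in> nb x \<Longrightarrow> reaches w j y \<Longrightarrow> reaches w (Suc j) x"

text \<open>With probability at least \<open>\<delta> ^ j\<close> the walk follows the given path
  into \<open>w\<close>, where it is killed after at most \<open>j + 1\<close> counted visits. If it
  leaves the path, \<open>green_le_diagonal\<close> bounds what follows.\<close>

lemma green_reaches:
  assumes "reaches w j x"
  shows "green z w 0 N x \<le> real (j + 1) + (1 - \<delta> ^ j) * green z w 0 N z"
  using assms
proof (induction arbitrary: N)
  case refl
  show ?case by (cases N) (auto simp: green_0 green_Suc)
next
  case (step y x j)
  let ?h = "\<lambda>N. green z w 0 N z"
  have \<delta>1: "\<delta> \<le> 1"
  proof -
    have "\<delta> \<le> P x y" by (rule P_ge[OF step(1)])
    also have "\<dots> \<le> (\<Sum>y\<in>nb x. P x y)" using step(1) P_nonneg finite_nb by (intro member_le_sum) auto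
    finally show ?thesis by (simp add: P_sum)
  qed
  have p: "0 \<le> 1 - \<delta> ^ Suc j" "0 \<le> 1 - \<delta> ^ j" using \<delta>1 \<delta>_pos power_le_one[of \<delta>] by (auto simp del: power_Suc)
  show ?case
  proof (cases N)
    case 0
    then show ?thesis by (simp add: green_0)
  next
    case (Suc M)
    have "green z w 0 N x \<le> 1 + (if x = w then 0 else \<Sum>y\<in>nb x. P x y * green z w 0 M y)"
      by (simp add: Suc green_Suc)
    also have "\<dots> \<le> 1 + ((1 - \<delta>) * ?h M + \<delta> * green z w 0 M y)"
      using P_average_le'[of x "green z w 0 M" "?h M", OF green_le_diagonal step(1)]
        mult_nonneg_nonneg[of "1 - \<delta>" "?h M"] mult_nonneg_nonneg[of \<delta> "green z w 0 M y"] \<delta>1 \<delta>_pos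
      by (auto simp: green_nonneg)
    also have "\<dots> \<le> 1 + ((1 - \<delta>) * ?h M + \<delta> * (real (j + 1) + (1 - \<delta> ^ j) * ?h M))"
      using step.IH[of M] \<delta>_pos by (intro add_left_mono mult_left_mono) auto
    also have "\<dots> = 1 + \<delta> * real (j + 1) + (1 - \<delta> ^ Suc j) * ?h M"
      by (simp add: algebra_simps)
    also have "\<dots> \<le> 1 + 1 * real (j + 1) + (1 - \<delta> ^ Suc j) * ?h N"
      using \<delta>1 p(1) green_mono[of M N] Suc by (intro add_mono mult_right_mono mult_left_mono) auto
    finally show ?thesis by simp
  qed
qed

text \<open>For \<open>m = 0\<close>, \<open>green_reaches\<close> at \<open>x = z\<close> bounds
  the diagonal value in terms of itself with factor \<open>1 - \<delta> ^ d\<close>; solving gives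
  \<open>D\<close>. Each of the \<open>m\<close> further allowed visits to \<open>w\<close> restarts
  the killed walk and adds at most \<open>D\<close>, estimated by \<open>D + 1\<close>.\<close>

lemma green_le:
  assumes "reaches w d z"
  shows "green z w m N x \<le> real (m + 1) * (real (d + 1) / \<delta> ^ d + 1)"
proof -
  define D where "D = real (d + 1) / \<delta> ^ d"
  have "green z w 0 N z * \<delta> ^ d \<le> real (d + 1)" for N
    using green_reaches[OF assms, of z N] by (simp add: algebra_simps)
  then have diag: "green z w 0 N z \<le> D" for N
    unfolding D_def using \<delta>_pos by (subst pos_le_divide_eq) auto
  then have D: "green z w 0 N x \<le> D" for N x
    using green_le_diagonal order_trans by blast
  have D0: "0 \<le> D" using \<delta>_pos by (simp add: D_def)
  have "green z w m N x \<le> green z w 0 N x + real m * (D + 1)"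
  proof (induction N arbitrary: m x)
    case 0
    then show ?case using D0 by (simp add: green_0)
  next
    case (Suc N)
    show ?case
    proof (cases "x = w")
      case True
      show ?thesis
      proof (cases m)
        case (Suc m')
        have "green z w m' N y \<le> D + real m' * (D + 1)" for y
          using Suc.IH[of m' y] D[of N y] by linarith
        then have "(\<Sum>y\<in>nb x. P x y * green z w m' N y) \<le> D + real m' * (D + 1)"
          by (intro P_average_le)
        then show ?thesis using True Suc by (simp add: green_Suc algebra_simps)
      qed simp
    next
      case False
      have "(\<Sum>y\<in>nb x. P x y * green z w m N y) \<le> (\<Sum>y\<in>nb x. P x y * (green z w 0 N y + real m * (D + 1)))"
        using Suc.IH P_nonneg by (intro sum_mono mult_left_mono) auto
      also have "\<dots> = (\<Sum>y\<in>nb x. P x y * green z w 0 N y) + real m * (D + 1)"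
        by (simp add: distrib_left sum.distrib P_sum flip: sum_distrib_right)
      finally show ?thesis using False by (simp add: green_Suc)
    qed
  qed
  also have "\<dots> \<le> D + real m * (D + 1)" using D by simp
  also have "\<dots> \<le> real (m + 1) * (D + 1)" by (simp add: algebra_simps)
  finally show ?thesis by (simp add: D_def)
qed

end

section \<open>Return probabilities of the lamps\<close>

locale lamp_walk = group H for H (structure) +
  fixes \<mu> :: "'a pmf"
  assumes supp_carrier: "set_pmf \<mu> \<subseteq> carrier H" and finite_supp: "finite (set_pmf \<mu>)"
begin

text \<open>The \<open>m\<close>-fold convolution power of \<open>\<mu>\<close>, that is, the law of
  a product of \<open>m\<close> independent switches, split according to the last factor.\<close>

primrec conv :: "nat \<Rightarrow> 'a \<Rightarrow> real" where
  "conv 0 h = of_bool (h = \<one>)"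
| "conv (Suc m) h = (\<Sum>u\<in>set_pmf \<mu>. pmf \<mu> u * conv m (h \<otimes> inv u))"

lemma supp_closed: "u \<in> set_pmf \<mu> \<Longrightarrow> u \<in> carrier H"
  using supp_carrier by blast

lemma sum_supp: "(\<Sum>u\<in>set_pmf \<mu>. pmf \<mu> u) = 1"
  using finite_supp by (simp add: sum_pmf_eq_1)

lemma conv_nonneg: "0 \<le> conv m h"
  by (induction m arbitrary: h) (auto intro!: sum_nonneg)

lemma inj_right_translate: "u \<in> carrier H \<Longrightarrow> inj_on (\<lambda>h. h \<otimes> u) (carrier H)"
  by (rule inj_onI) simp

text \<open>Stated for finite sets because \<open>H\<close> may be infinite; right translation is
  injective, so the induction hypothesis applies to the translated set.\<close>

lemma sum_conv_le_1:
  assumes "finite F" "F \<subseteq> carrier H"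
  shows "(\<Sum>h\<in>F. conv m h) \<le> 1"
  using assms
proof (induction m arbitrary: F)
  case 0
  then have "(\<Sum>h\<in>F. conv 0 h) = (if \<one> \<in> F then 1 else 0)"
    by (simp add: of_bool_def sum.delta)
  then show ?case by simp
next
  case (Suc m)
  have inner: "(\<Sum>h\<in>F. conv m (h \<otimes> inv u)) \<le> 1" if u: "u \<in> set_pmf \<mu>" for u
  proof -
    have "inj_on (\<lambda>h. h \<otimes> inv u) F"
      using inj_right_translate[of "inv u"] supp_closed[OF u] Suc.prems inj_on_subset by auto
    then have "(\<Sum>h\<in>F. conv m (h \<otimes> inv u)) = (\<Sum>h\<in>(\<lambda>h. h \<otimes> inv u) ` F. conv m h)"
      by (simp add: sum.reindex)
    also have "\<dots> \<le> 1"
      using Suc.prems supp_closed[OF u] by (intro Suc.IH) auto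
    finally show ?thesis .
  qed
  have "(\<Sum>h\<in>F. conv (Suc m) h) = (\<Sum>u\<in>set_pmf \<mu>. pmf \<mu> u * (\<Sum>h\<in>F. conv m (h \<otimes> inv u)))"
    by (simp add: sum_distrib_left) (rule sum.swap)
  also have "\<dots> \<le> (\<Sum>u\<in>set_pmf \<mu>. pmf \<mu> u * 1)"
    using inner by (intro sum_mono mult_left_mono) auto
  finally show ?case by (simp add: sum_supp)
qed

lemma conv_le_1: "h \<in> carrier H \<Longrightarrow> conv m h \<le> 1"
  using sum_conv_le_1[of "{h}" m] by simp

text \<open>One uniform factor averages the previous law over the whole group, and that law has
  total mass 1.\<close>

lemma conv_uniform:
  assumes fin: "finite (carrier H)" and unif: "\<mu> = pmf_of_set (carrier H)" and h: "h \<in> carrier H"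
  shows "conv (Suc m) h = 1 / real (card (carrier H))"
proof -
  have ne: "carrier H \<noteq> {}" using one_closed by blast
  have supp: "set_pmf \<mu> = carrier H" and pmf: "\<And>u. u \<in> carrier H \<Longrightarrow> pmf \<mu> u = 1 / real (card (carrier H))"
    using fin ne unif by (auto simp: indicator_def)
  have translate: "(\<Sum>u\<in>carrier H. f (h \<otimes> inv u)) = (\<Sum>u\<in>carrier H. f u)"
    if "h \<in> carrier H" for f :: "'a \<Rightarrow> real" and h
    by (rule sum.reindex_bij_witness[of _ "\<lambda>u. inv u \<otimes> h" "\<lambda>u. h \<otimes> inv u"])
       (use that in \<open>auto simp: inv_mult_group m_assoc[symmetric]\<close>, simp_all add: m_assoc)
  have step: "conv (Suc m) h = (\<Sum>u\<in>carrier H. conv m u) / real (card (carrier H))"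
    if "h \<in> carrier H" for m h
  proof -
    have "conv (Suc m) h = (\<Sum>u\<in>carrier H. 1 / real (card (carrier H)) * conv m (h \<otimes> inv u))"
      by (simp add: supp pmf)
    also have "\<dots> = (\<Sum>u\<in>carrier H. conv m (h \<otimes> inv u)) / real (card (carrier H))"
      by (simp add: sum_divide_distrib)
    finally show ?thesis by (simp only: translate[OF that])
  qed
  have "(\<Sum>u\<in>carrier H. conv m u) = 1"
  proof (induction m)
    case 0
    show ?case using fin by (simp add: of_bool_def sum.delta)
  next
    case (Suc m)
    then have "(\<Sum>u\<in>carrier H. conv (Suc m) u) = (\<Sum>u\<in>carrier H. 1 / real (card (carrier H)))"
      by (intro sum.cong refl) (simp only: step)
    then show ?case using fin ne by simp
  qed
  then show ?thesis by (simp only: step[OF h])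
qed

section \<open>Decay of the largest point mass of the convolution powers\<close>

definition conv_sup :: "nat \<Rightarrow> real" where
  "conv_sup m = (SUP h\<in>carrier H. conv m h)"

lemma bdd_conv: "bdd_above (conv m ` carrier H)"
  using conv_le_1 by (intro bdd_aboveI[of _ 1]) auto

lemma conv_le_sup: "h \<in> carrier H \<Longrightarrow> conv m h \<le> conv_sup m"
  unfolding conv_sup_def by (intro cSUP_upper bdd_conv)

lemma conv_sup_Suc: "conv_sup (Suc m) \<le> conv_sup m"
proof -
  have "conv (Suc m) h \<le> conv_sup m" if "h \<in> carrier H" for h
  proof -
    have "conv (Suc m) h \<le> (\<Sum>u\<in>set_pmf \<mu>. pmf \<mu> u * conv_sup m)"
      using that supp_closed by (auto intro!: sum_mono mult_left_mono conv_le_sup)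
    then show ?thesis by (simp add: sum_supp flip: sum_distrib_right)
  qed
  then show ?thesis unfolding conv_sup_def[of "Suc m"] by (intro cSUP_least) auto
qed

text \<open>Keeps the term of \<open>s\<close> and bounds all the others by the supremum.\<close>

lemma conv_Suc_le:
  assumes "s \<in> set_pmf \<mu>" "h \<in> carrier H"
  shows "conv (Suc m) h \<le> (1 - pmf \<mu> s) * conv_sup m + pmf \<mu> s * conv m (h \<otimes> inv s)"
proof -
  have "pmf \<mu> s * (conv_sup m - conv m (h \<otimes> inv s))
      \<le> (\<Sum>u\<in>set_pmf \<mu>. pmf \<mu> u * (conv_sup m - conv m (h \<otimes> inv u)))"
    using assms conv_le_sup supp_closed finite_supp
    by (intro member_le_sum[of s]) (auto intro!: mult_nonneg_nonneg simp: conv_le_sup)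
  also have "\<dots> = conv_sup m - conv (Suc m) h"
    by (simp add: right_diff_distrib sum_subtractf sum_supp flip: sum_distrib_right)
  finally show ?thesis by (simp add: algebra_simps)
qed

text \<open>Iterates \<open>conv_Suc_le\<close> along the word, so \<open>c\<close> is the product
  of the probabilities of its letters. It depends neither on \<open>m\<close> nor on
  \<open>h\<close>, which the limit argument relies on.\<close>

lemma conv_word_le:
  assumes "set ss \<subseteq> set_pmf \<mu>"
  shows "\<exists>c. 0 < c \<and> c \<le> 1 \<and> (\<forall>m. \<forall>h\<in>carrier H.
     conv (m + length ss) h \<le> (1 - c) * conv_sup m + c * conv m (h \<otimes> inv (word_prod H ss)))"
  using assms
proof (induction ss)
  case Nil
  show ?case by (rule exI[of _ 1]) simp
next
  case (Cons s ss)
  then obtain c where c: "0 < c" "c \<le> 1" and IH: "\<And>m h. h \<in> carrier H \<Longrightarrow>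
     conv (m + length ss) h \<le> (1 - c) * conv_sup m + c * conv m (h \<otimes> inv (word_prod H ss))"
    by auto
  have s: "s \<in> set_pmf \<mu>" "s \<in> carrier H" using Cons.prems supp_closed by auto
  have g: "word_prod H ss \<in> carrier H" using Cons.prems supp_carrier by auto
  have ps: "0 < pmf \<mu> s" "pmf \<mu> s \<le> 1" using s by (auto simp: pmf_positive pmf_le_1)
  show ?case
  proof (intro exI[of _ "c * pmf \<mu> s"] conjI allI ballI)
    show "0 < c * pmf \<mu> s" "c * pmf \<mu> s \<le> 1" using c ps by (auto simp: mult_le_one)
    fix m h assume h: "h \<in> carrier H"
    have "conv (m + length (s # ss)) h = conv (Suc m + length ss) h" by simp
    also have "\<dots> \<le> (1 - c) * conv_sup (Suc m) + c * conv (Suc m) (h \<otimes> inv (word_prod H ss))"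
      by (rule IH[OF h])
    also have "\<dots> \<le> (1 - c) * conv_sup m + c * ((1 - pmf \<mu> s) * conv_sup m +
        pmf \<mu> s * conv m (h \<otimes> inv (word_prod H ss) \<otimes> inv s))"
      using c h g by (intro add_mono mult_left_mono conv_sup_Suc conv_Suc_le s) auto
    also have "h \<otimes> inv (word_prod H ss) \<otimes> inv s = h \<otimes> inv (word_prod H (s # ss))"
      using h g s by (simp add: inv_mult_group m_assoc)
    finally show "conv (m + length (s # ss)) h
        \<le> (1 - c * pmf \<mu> s) * conv_sup m + c * pmf \<mu> s * conv m (h \<otimes> inv (word_prod H (s # ss)))"
      by (simp add: algebra_simps)
  qed
qed

text \<open>A word can only be lengthened by an even amount, via \<open>s\<close> followed by its inverse; hence the
  two consecutive lengths.\<close>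

lemma ex_many_words:
  assumes sym: "\<And>s. s \<in> set_pmf \<mu> \<Longrightarrow> inv s \<in> set_pmf \<mu>" and gen: "generate H (set_pmf \<mu>) = carrier H"
    and inf: "infinite (carrier H)"
  shows "\<exists>j F. finite F \<and> N \<le> card F \<and>
    F \<subseteq> word_prod H ` {ss. set ss \<subseteq> set_pmf \<mu> \<and> length ss = j}"
proof -
  interpret symmetric_generators H "set_pmf \<mu>"
    by unfold_locales (auto simp: sym gen supp_carrier)
  define R where "R j = word_prod H ` {ss. set ss \<subseteq> set_pmf \<mu> \<and> length ss = j}" for j
  obtain s where s: "s \<in> set_pmf \<mu>" using set_pmf_not_empty[of \<mu>] by blast
  have "R j \<subseteq> R (j + 2)" for j
  proof
    fix h assume "h \<in> R j"
    then obtain ss where ss: "set ss \<subseteq> set_pmf \<mu>" "length ss = j" "h = word_prod H ss" by (auto simp: R_def)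
    have "word_prod H (s # inv s # ss) = h"
      using ss s supp_closed[OF s] word_closed[OF ss(1)] by (simp add: m_assoc[symmetric])
    moreover have "set (s # inv s # ss) \<subseteq> set_pmf \<mu>" "length (s # inv s # ss) = j + 2"
      using ss s sym by auto
    ultimately show "h \<in> R (j + 2)" unfolding R_def by blast
  qed
  then have pad: "R j \<subseteq> R (j + 2 * k)" for j k
  proof (induction k)
    case (Suc k)
    then show ?case using \<open>\<And>j. R j \<subseteq> R (j + 2)\<close>[of "j + 2 * k"] by auto
  qed simp
  \<comment> \<open>Twice as many elements as required, since they will be split between two word
    lengths.\<close>
  obtain F where F: "finite F" "card F = 2 * N" "F \<subseteq> carrier H"
    using infinite_arbitrarily_large[OF inf] by blast
  have "\<forall>h\<in>F. \<exists>j. h \<in> R j" using F ex_word unfolding R_def by blast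
  then obtain l where l: "\<And>h. h \<in> F \<Longrightarrow> h \<in> R (l h)" by metis
  define n where "n = Max (insert 0 (l ` F))"
  have "F \<subseteq> R n \<union> R (Suc n)"
  proof
    fix h assume h: "h \<in> F"
    have "l h \<le> n" unfolding n_def using F h by (intro Max_ge) auto
    then have "n = l h + 2 * ((n - l h) div 2) \<or> Suc n = l h + 2 * ((Suc n - l h) div 2)"
      by presburger
    then show "h \<in> R n \<union> R (Suc n)" using pad l[OF h] by (metis UnI1 UnI2 subsetD)
  qed
  then have "F = (F \<inter> R n) \<union> (F \<inter> R (Suc n))" by blast
  then have "2 * N \<le> card (F \<inter> R n) + card (F \<inter> R (Suc n))"
    using card_Un_le F(2) by metis
  then have "N \<le> card (F \<inter> R n) \<or> N \<le> card (F \<inter> R (Suc n))" by linarith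
  then obtain j where "N \<le> card (F \<inter> R j)" by blast
  then show ?thesis using F(1) by (intro exI[of _ j] exI[of _ "F \<inter> R j"]) (simp add: R_def)
qed

text \<open>If \<open>conv_sup\<close> decreases to \<open>L > 0\<close> and \<open>conv (m + j)\<close> is almost \<open>L\<close> at \<open>x\<close> for large \<open>m\<close>, then
  \<open>conv m\<close> is almost \<open>L\<close> at \<open>x g\<inverse>\<close> for every product \<open>g\<close> of \<open>j\<close> support elements; for suitable \<open>j\<close>
  there are more than \<open>2 / L\<close> such \<open>g\<close>.\<close>

lemma conv_sup_tendsto_0:
  assumes sym: "\<And>s. s \<in> set_pmf \<mu> \<Longrightarrow> inv s \<in> set_pmf \<mu>" and gen: "generate H (set_pmf \<mu>) = carrier H"
    and inf: "infinite (carrier H)"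
  shows "conv_sup \<longlonglongrightarrow> 0"
proof -
  have dec: "decseq conv_sup" by (intro decseq_SucI conv_sup_Suc)
  have "0 \<le> conv_sup m" for m
    using conv_le_sup[OF one_closed] conv_nonneg order_trans by blast
  then obtain L where L: "conv_sup \<longlonglongrightarrow> L" "\<And>m. L \<le> conv_sup m"
    using decseq_convergent[OF dec, of 0] by blast
  have "0 \<le> L" using L(1) \<open>\<And>m. 0 \<le> conv_sup m\<close> by (intro LIMSEQ_le_const) auto
  moreover have "\<not> 0 < L"
  proof
    assume L0: "0 < L"
    \<comment> \<open>More than \<open>2 / L\<close> points of mass at least \<open>L / 2\<close>
      exceed total mass 1.\<close>
    obtain N where N: "2 / L < real N" using reals_Archimedean2 by blast
    obtain j F where F: "finite F" "N \<le> card F"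
        "F \<subseteq> word_prod H ` {ss. set ss \<subseteq> set_pmf \<mu> \<and> length ss = j}"
      using ex_many_words[OF assms, of N] by blast
    have Fc: "F \<subseteq> carrier H" using F(3) supp_carrier by auto
    have "\<forall>g\<in>F. \<exists>c. 0 < c \<and> c \<le> 1 \<and> (\<forall>m. \<forall>h\<in>carrier H.
       conv (m + j) h \<le> (1 - c) * conv_sup m + c * conv m (h \<otimes> inv g))"
    proof
      fix g assume "g \<in> F"
      then obtain ss where "set ss \<subseteq> set_pmf \<mu>" "length ss = j" "g = word_prod H ss" using F(3) by blast
      then show "\<exists>c. 0 < c \<and> c \<le> 1 \<and> (\<forall>m. \<forall>h\<in>carrier H.
          conv (m + j) h \<le> (1 - c) * conv_sup m + c * conv m (h \<otimes> inv g))"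
        using conv_word_le[of ss] by simp
    qed
    then obtain c where c: "\<And>g. g \<in> F \<Longrightarrow> 0 < c g \<and> c g \<le> 1"
      "\<And>g m h. g \<in> F \<Longrightarrow> h \<in> carrier H \<Longrightarrow>
         conv (m + j) h \<le> (1 - c g) * conv_sup m + c g * conv m (h \<otimes> inv g)"
      by metis
    define c0 where "c0 = Min (insert 1 (c ` F))"
    have c0: "0 < c0" "\<And>g. g \<in> F \<Longrightarrow> c0 \<le> c g"
      unfolding c0_def using F(1) c(1) by (auto intro!: Min_le)
    \<comment> \<open>Chosen so that \<open>2 * \<epsilon> = c0 * (L / 2)\<close>: a loss of
      \<open>2 * \<epsilon>\<close> after \<open>j\<close> steps means a loss of at most
      \<open>L / 2\<close> at each translate.\<close>
    define \<epsilon> where "\<epsilon> = c0 * L / 4"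
    have \<epsilon>: "0 < \<epsilon>" using c0 L0 by (simp add: \<epsilon>_def)
    obtain m where m: "conv_sup m < L + \<epsilon>"
      using order_tendstoD(2)[OF L(1), of "L + \<epsilon>"] \<epsilon> by (auto simp: eventually_sequentially)
    have "L - \<epsilon> < (SUP h\<in>carrier H. conv (m + j) h)"
      using L(2)[of "m + j"] \<epsilon> by (simp add: conv_sup_def)
    then obtain x where x: "x \<in> carrier H" "L - \<epsilon> < conv (m + j) x"
      by (subst (asm) less_cSUP_iff) (auto simp: bdd_conv)
    have big: "L / 2 \<le> conv m (x \<otimes> inv g)" if g: "g \<in> F" for g
    proof -
      have gc: "x \<otimes> inv g \<in> carrier H" using g Fc x by auto
      have "c g * (conv_sup m - conv m (x \<otimes> inv g)) \<le> conv_sup m - conv (m + j) x"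
        using c(2)[OF g x(1), of m] by (simp add: algebra_simps)
      also have "\<dots> \<le> 2 * \<epsilon>" using m x by linarith
      finally have "c g * (conv_sup m - conv m (x \<otimes> inv g)) \<le> 2 * \<epsilon>" .
      moreover have "c0 * (conv_sup m - conv m (x \<otimes> inv g)) \<le> c g * (conv_sup m - conv m (x \<otimes> inv g))"
        using c0(2)[OF g] conv_le_sup[OF gc] by (intro mult_right_mono) auto
      ultimately have "c0 * (conv_sup m - conv m (x \<otimes> inv g)) \<le> c0 * (L / 2)"
        unfolding \<epsilon>_def by linarith
      then have "conv_sup m - conv m (x \<otimes> inv g) \<le> L / 2" using c0(1) by simp
      then show ?thesis using L(2)[of m] by linarith
    qed
    have "inj_on (\<lambda>g. x \<otimes> inv g) F"
      using x Fc by (auto intro!: inj_onI) (metis inv_closed inv_inv l_cancel subsetD)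
    then have "(\<Sum>g\<in>F. conv m (x \<otimes> inv g)) = (\<Sum>h\<in>(\<lambda>g. x \<otimes> inv g) ` F. conv m h)"
      by (simp add: sum.reindex)
    also have "\<dots> \<le> 1" using F(1) Fc x by (intro sum_conv_le_1) auto
    finally have "(\<Sum>g\<in>F. conv m (x \<otimes> inv g)) \<le> 1" .
    moreover have "(\<Sum>g\<in>F. L / 2) \<le> (\<Sum>g\<in>F. conv m (x \<otimes> inv g))" using big by (rule sum_mono)
    ultimately have "real (card F) * (L / 2) \<le> 1" by simp
    moreover have "2 / L < real (card F)" using N F(2) by linarith
    ultimately show False using L0 by (simp add: field_simps)
  qed
  ultimately show ?thesis using L(1) by simp
qed

section \<open>Lamps along a fixed base path\<close>

definition lamp :: "(nat \<Rightarrow> 'g) \<Rightarrow> (nat \<Rightarrow> 'a \<times> 'a) \<Rightarrow> nat \<Rightarrow> 'g \<Rightarrow> 'a" where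
  "lamp z uv n = lamps H (\<lambda>i _. z i) (\<lambda>i _. fst (uv i)) (\<lambda>i _. snd (uv i)) n ()"

lemma lamps_eq_lamp: "lamps H Z U V n \<omega> = lamp (\<lambda>i. Z i \<omega>) (\<lambda>i. (U i \<omega>, V i \<omega>)) n"
  unfolding lamp_def by (induction n) (simp_all add: Let_def)

lemma lamp_cong:
  "(\<And>i. i \<le> n \<Longrightarrow> z i = z' i \<and> (0 < i \<longrightarrow> uv i = uv' i)) \<Longrightarrow> lamp z uv n = lamp z' uv' n"
  unfolding lamp_def by (induction n) (simp_all add: Let_def)

lemma lamp_0: "lamp z uv 0 = (\<lambda>g. \<one>)"
  by (simp add: lamp_def)

lemma lamp_Suc:
  "lamp z uv (Suc n) =
     (let L = (lamp z uv n)(z n := lamp z uv n (z n) \<otimes> fst (uv (Suc n)))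
      in L(z (Suc n) := L (z (Suc n)) \<otimes> snd (uv (Suc n))))"
  by (simp add: lamp_def Let_def)

text \<open>Extensional functions make this set finite and each switch sequence unique; indices
  start at 1, as in the process.\<close>

definition switches :: "nat \<Rightarrow> (nat \<Rightarrow> 'a \<times> 'a) set" where
  "switches n = {1..n} \<rightarrow>\<^sub>E set_pmf \<mu> \<times> set_pmf \<mu>"

definition switch_weight :: "nat \<Rightarrow> (nat \<Rightarrow> 'a \<times> 'a) \<Rightarrow> real" where
  "switch_weight n uv = (\<Prod>i\<in>{1..n}. pmf \<mu> (fst (uv i)) * pmf \<mu> (snd (uv i)))"

primrec lamp_steps :: "(nat \<Rightarrow> 'g) \<Rightarrow> nat \<Rightarrow> 'g \<Rightarrow> nat" where
  "lamp_steps z 0 g = 0"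
| "lamp_steps z (Suc n) g = lamp_steps z n g + of_bool (g = z n) + of_bool (g = z (Suc n))"

lemma finite_switches: "finite (switches n)"
  unfolding switches_def by (intro finite_PiE) (auto simp: finite_supp)

lemma sum_switches_Suc:
  "(\<Sum>uv\<in>switches (Suc n). f uv) =
     (\<Sum>a\<in>set_pmf \<mu>. \<Sum>b\<in>set_pmf \<mu>. \<Sum>uv\<in>switches n. f (uv(Suc n := (a, b))))"
proof -
  have "switches (Suc n) = (\<lambda>(y, g). g(Suc n := y)) ` ((set_pmf \<mu> \<times> set_pmf \<mu>) \<times> switches n)"
    unfolding switches_def by (simp add: atLeastAtMostSuc_conv PiE_insert_eq)
  moreover have "inj_on (\<lambda>(y, g). g(Suc n := y)) ((set_pmf \<mu> \<times> set_pmf \<mu>) \<times> switches n)"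
    unfolding switches_def by (rule inj_combinator) simp
  ultimately have "(\<Sum>uv\<in>switches (Suc n). f uv) =
      (\<Sum>(y, uv)\<in>(set_pmf \<mu> \<times> set_pmf \<mu>) \<times> switches n. f (uv(Suc n := y)))"
    by (simp add: sum.reindex case_prod_unfold)
  also have "\<dots> = (\<Sum>y\<in>set_pmf \<mu> \<times> set_pmf \<mu>. \<Sum>uv\<in>switches n. f (uv(Suc n := y)))"
    by (simp add: sum.cartesian_product)
  also have "\<dots> = (\<Sum>a\<in>set_pmf \<mu>. \<Sum>b\<in>set_pmf \<mu>. \<Sum>uv\<in>switches n. f (uv(Suc n := (a, b))))"
    using sum.cartesian_product[of "\<lambda>a b. \<Sum>uv\<in>switches n. f (uv(Suc n := (a, b)))" "set_pmf \<mu>" "set_pmf \<mu>"]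
    by (simp add: case_prod_unfold)
  finally show ?thesis .
qed

lemma switch_weight_Suc:
  "switch_weight (Suc n) (uv(Suc n := (a, b))) = pmf \<mu> a * (pmf \<mu> b * switch_weight n uv)"
proof -
  have "switch_weight n (uv(Suc n := (a, b))) = switch_weight n uv"
    unfolding switch_weight_def by (rule prod.cong) auto
  then show ?thesis
    unfolding switch_weight_def by (simp add: atLeastAtMostSuc_conv)
qed

lemma sum_switch_weight: "(\<Sum>uv\<in>switches n. switch_weight n uv) = 1"
proof (induction n)
  case 0
  show ?case by (simp add: switches_def switch_weight_def)
next
  case (Suc n)
  then show ?case
    by (simp add: sum_switches_Suc switch_weight_Suc sum_supp flip: sum_distrib_left)
qed

text \<open>Averaging over one switch at \<open>x\<close> is one convolution step in the factor of
  \<open>x\<close> and leaves the other factors alone.\<close>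

lemma sum_prod_conv_update:
  assumes "finite A" "x \<in> A"
  shows "(\<Sum>a\<in>set_pmf \<mu>. pmf \<mu> a * (\<Prod>g\<in>A. conv (c g) ((l(x := l x \<otimes> inv a)) g)))
       = (\<Prod>g\<in>A. conv (c g + of_bool (g = x)) (l g))"
proof -
  have "(\<Prod>g\<in>A. conv (c g) ((l(x := l x \<otimes> inv a)) g)) =
      conv (c x) (l x \<otimes> inv a) * (\<Prod>g\<in>A - {x}. conv (c g) (l g))" for a
    by (subst prod.remove[OF assms]) simp
  then have "(\<Sum>a\<in>set_pmf \<mu>. pmf \<mu> a * (\<Prod>g\<in>A. conv (c g) ((l(x := l x \<otimes> inv a)) g)))
      = conv (Suc (c x)) (l x) * (\<Prod>g\<in>A - {x}. conv (c g) (l g))"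
    by (simp only: conv.simps sum_distrib_right mult.assoc)
  also have "\<dots> = (\<Prod>g\<in>A. conv (c g + of_bool (g = x)) (l g))"
    by (subst prod.remove[OF assms]) simp
  finally show ?thesis .
qed

lemma lamp_closed:
  "uv \<in> switches n \<Longrightarrow> m \<le> n \<Longrightarrow> lamp z uv m g \<in> carrier H"
proof (induction m arbitrary: g)
  case (Suc m)
  have "uv (Suc m) \<in> set_pmf \<mu> \<times> set_pmf \<mu>"
    using PiE_mem[of uv "{1..n}" "\<lambda>_. set_pmf \<mu> \<times> set_pmf \<mu>" "Suc m"] Suc.prems
    by (simp add: switches_def)
  then have "fst (uv (Suc m)) \<in> carrier H" "snd (uv (Suc m)) \<in> carrier H"
    using supp_carrier by (auto simp: mem_Times_iff)
  moreover have "lamp z uv m g \<in> carrier H" for g using Suc by simp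
  ultimately show ?case by (simp add: lamp_Suc Let_def)
qed (simp add: lamp_0)

text \<open>Independence of the lamps given the path: the lamp at \<open>g\<close> is a product of
  \<open>lamp_steps z n g\<close> independent switches. The induction undoes the last step on the
  target configuration, hence is general in \<open>l\<close>.\<close>

lemma sum_lamp_eq:
  assumes "finite A" "\<And>i. i \<le> n \<Longrightarrow> z i \<in> A" "\<And>g. g \<in> A \<Longrightarrow> l g \<in> carrier H"
  shows "(\<Sum>uv\<in>switches n. switch_weight n uv * of_bool (\<forall>g\<in>A. lamp z uv n g = l g))
       = (\<Prod>g\<in>A. conv (lamp_steps z n g) (l g))"
  using assms(2,3)
proof (induction n arbitrary: l)
  case 0
  have "(\<Prod>g\<in>A. of_bool (l g = \<one>)) = (of_bool (\<forall>g\<in>A. l g = \<one>) :: real)"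
    using assms(1) by (induction A rule: finite_induct) auto
  moreover have "(\<forall>g\<in>A. \<one> = l g) \<longleftrightarrow> (\<forall>g\<in>A. l g = \<one>)" by metis
  ultimately show ?case by (simp add: switches_def switch_weight_def lamp_0)
next
  case (Suc n)
  define x y where "x = z n" and "y = z (Suc n)"
  have xy: "x \<in> A" "y \<in> A" using Suc.prems by (auto simp: x_def y_def)
  \<comment> \<open>The arrival switch is applied last and so is undone first; the nested updates
    also cover \<open>x = y\<close>.\<close>
  define l1 where "l1 b = l(y := l y \<otimes> inv b)" for b
  define l2 where "l2 a b = (l1 b)(x := l1 b x \<otimes> inv a)" for a b
  have l1c: "l1 b g \<in> carrier H" if "g \<in> A" "b \<in> set_pmf \<mu>" for b g
    using that Suc.prems(2) xy supp_closed by (simp add: l1_def)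
  have l2c: "l2 a b g \<in> carrier H" if "g \<in> A" "a \<in> set_pmf \<mu>" "b \<in> set_pmf \<mu>" for a b g
    using that l1c xy supp_closed by (simp add: l2_def)
  have iff: "(\<forall>g\<in>A. lamp z (uv(Suc n := (a, b))) (Suc n) g = l g) \<longleftrightarrow> (\<forall>g\<in>A. lamp z uv n g = l2 a b g)"
    if ab: "a \<in> set_pmf \<mu>" "b \<in> set_pmf \<mu>" and uv: "uv \<in> switches n" for a b uv
  proof -
    define L where "L = lamp z uv n"
    have Lc: "L g \<in> carrier H" for g unfolding L_def using lamp_closed[OF uv, of n] by simp
    have "lamp z (uv(Suc n := (a, b))) n = L"
      unfolding L_def by (rule lamp_cong) simp
    then have eq: "lamp z (uv(Suc n := (a, b))) (Suc n) = (let L' = L(x := L x \<otimes> a) in L'(y := L' y \<otimes> b))"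
      by (simp add: lamp_Suc x_def y_def)
    have cancel: "p \<otimes> c = q \<longleftrightarrow> p = q \<otimes> inv c" if "p \<in> carrier H" "q \<in> carrier H" "c \<in> set_pmf \<mu>" for p q c
      using that supp_closed by (metis inv_solve_right)
    define L1 where "L1 = L(x := L x \<otimes> a)"
    have L1c: "L1 g \<in> carrier H" for g using Lc ab supp_closed by (simp add: L1_def)
    have "(L1(y := L1 y \<otimes> b)) g = l g \<longleftrightarrow> L1 g = l1 b g" if "g \<in> A" for g
      using that cancel[OF L1c _ ab(2), of "l y" y] Suc.prems(2) xy by (auto simp: l1_def)
    moreover have "L1 g = l1 b g \<longleftrightarrow> L g = l2 a b g" if "g \<in> A" for g
      using that cancel[OF Lc l1c[OF xy(1) ab(2)] ab(1), of x] by (auto simp: l2_def L1_def)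
    ultimately show ?thesis unfolding eq Let_def L1_def[symmetric] L_def[symmetric] by blast
  qed
  have "(\<Sum>uv\<in>switches (Suc n). switch_weight (Suc n) uv * of_bool (\<forall>g\<in>A. lamp z uv (Suc n) g = l g)) =
    (\<Sum>a\<in>set_pmf \<mu>. \<Sum>b\<in>set_pmf \<mu>. \<Sum>uv\<in>switches n.
       pmf \<mu> a * (pmf \<mu> b * switch_weight n uv) * of_bool (\<forall>g\<in>A. lamp z uv n g = l2 a b g))"
    unfolding sum_switches_Suc switch_weight_Suc by (intro sum.cong refl) (simp only: iff)
  also have "\<dots> = (\<Sum>a\<in>set_pmf \<mu>. \<Sum>b\<in>set_pmf \<mu>. pmf \<mu> b * (pmf \<mu> a *
       (\<Sum>uv\<in>switches n. switch_weight n uv * of_bool (\<forall>g\<in>A. lamp z uv n g = l2 a b g))))"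
    by (simp only: sum_distrib_left mult_ac)
  also have "\<dots> = (\<Sum>a\<in>set_pmf \<mu>. \<Sum>b\<in>set_pmf \<mu>. pmf \<mu> b * (pmf \<mu> a *
       (\<Prod>g\<in>A. conv (lamp_steps z n g) (l2 a b g))))"
    using Suc.prems(1) l2c by (intro sum.cong refl arg_cong2[where f="(*)"] Suc.IH) auto
  also have "\<dots> = (\<Sum>b\<in>set_pmf \<mu>. pmf \<mu> b * (\<Sum>a\<in>set_pmf \<mu>. pmf \<mu> a *
       (\<Prod>g\<in>A. conv (lamp_steps z n g) (l2 a b g))))"
    by (subst sum.swap) (simp only: sum_distrib_left)
  also have "\<dots> = (\<Prod>g\<in>A. conv (lamp_steps z (Suc n) g) (l g))"
    unfolding l2_def sum_prod_conv_update[OF assms(1) xy(1)]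
    unfolding l1_def
    using sum_prod_conv_update[OF assms(1) xy(2), of "\<lambda>g. lamp_steps z n g + of_bool (g = x)" l]
    by (simp add: x_def y_def)
  finally show ?case .
qed

end

section \<open>Summing over the least visited site\<close>

context infinite_cayley_graph
begin

lemma card_gens_pos: "0 < card S"
  using card_sphere_pos[of 1] card_sphere_le[of 1] by simp

text \<open>Every numerator is at least 1, and the common denominator is at most
  \<open>lam * card S\<close> because a vertex has at most \<open>card S\<close> neighbours.\<close>

lemma elliptic_chain_homesick:
  assumes "1 \<le> lam"
  shows "elliptic_chain (cay_nbrs G S) (homesick_trans G S lam) (1 / (lam * real (card S)))"
proof
  fix x :: 'a
  show fin: "finite (cay_nbrs G S x)" by (simp add: cay_nbrs_def finite_gens)
  define n where "n = cay_nbrs G S x"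
  define c where "c = closer_nbrs G S x"
  define D where "D = lam * real (card c) + real (card (n - c))"
  have cn: "c \<subseteq> n" by (auto simp: c_def n_def closer_nbrs_def)
  have finc: "finite n" "finite c" using fin cn finite_subset by (auto simp: n_def)
  have card: "card n = card c + card (n - c)"
    using finc cn by (metis card_Diff_subset card_mono le_add_diff_inverse)
  have "S \<noteq> {}" using card_gens_pos by auto
  then have "n \<noteq> {}" by (simp add: n_def cay_nbrs_def)
  then have "0 < card n" using finc by (simp add: card_gt_0_iff)
  have ge: "real (card n) \<le> D"
    using assms mult_right_mono[of 1 lam "real (card c)"] by (simp add: D_def card)
  have D: "0 < D" using ge \<open>0 < card n\<close> by linarith
  have P: "homesick_trans G S lam x y = (if y \<in> n then (if y \<in> c then lam else 1) / D else 0)" for y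
    by (simp add: homesick_trans_def n_def c_def D_def)
  have "(\<Sum>y\<in>n. if y \<in> c then lam else 1) = D"
    using sum.subset_diff[OF cn finc(1), of "\<lambda>y. if y \<in> c then lam else 1"] by (simp add: D_def)
  then have "(\<Sum>y\<in>n. homesick_trans G S lam x y) = 1"
    using D by (simp add: P flip: sum_divide_distrib)
  then show "(\<Sum>y\<in>cay_nbrs G S x. homesick_trans G S lam x y) = 1" by (simp add: n_def)
  fix y assume "y \<in> cay_nbrs G S x"
  then have "1 / D \<le> homesick_trans G S lam x y"
    using assms D by (auto simp: P n_def divide_right_mono)
  moreover have "D \<le> lam * real (card S)"
  proof -
    have "D \<le> lam * real (card n)"
      using assms mult_right_mono[of 1 lam "real (card (n - c))"] by (simp add: D_def card distrib_left)
    also have "card n \<le> card S" unfolding n_def cay_nbrs_def by (rule card_image_le[OF finite_gens])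
    finally show ?thesis using assms by (simp add: mult_left_mono order_trans)
  qed
  then have "1 / (lam * real (card S)) \<le> 1 / D" using D by (intro divide_left_mono) auto
  ultimately show "1 / (lam * real (card S)) \<le> homesick_trans G S lam x y" by linarith
next
  show "0 < 1 / (lam * real (card S))" using assms card_gens_pos by simp
qed

text \<open>Strict, so as to hold exactly the sites closer to the root than a nearest exceptional
  one.\<close>

definition open_ball :: "nat \<Rightarrow> 'a set" where "open_ball r = {x \<in> carrier G. len x < r}"

lemma open_ball_Suc: "open_ball (Suc r) = word_ball r"
  by (auto simp: open_ball_def word_ball_def)

lemma card_open_ball_ge: "r \<le> card (open_ball r)"
  using card_ball_gt by (cases r) (auto simp: open_ball_Suc Suc_le_eq)

lemma sum_word_ball:
  fixes f :: "nat \<Rightarrow> real"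
  shows "(\<Sum>w\<in>word_ball N. f (len w)) = (\<Sum>r\<le>N. real (card (word_sphere r)) * f r)"
proof (induction N)
  case 0
  have "word_ball 0 = word_sphere 0" by (auto simp: word_ball_def word_sphere_def)
  then show ?case by (simp add: word_sphere_def)
next
  case (Suc N)
  have "(\<Sum>w\<in>word_ball (Suc N). f (len w)) = (\<Sum>w\<in>word_ball N. f (len w)) + (\<Sum>w\<in>word_sphere (Suc N). f (len w))"
    unfolding ball_Suc
    by (rule sum.union_disjoint[OF finite_ball finite_sphere]) (auto simp: word_ball_def word_sphere_def)
  then show ?case using Suc by (simp add: word_sphere_def)
qed

end

locale homesick_walk = infinite_cayley_graph +
  fixes lam :: real
  assumes lam_ge_1: "1 \<le> lam"
begin

abbreviation ellipticity :: real where "ellipticity \<equiv> 1 / (lam * real (card S))"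

sublocale elliptic_chain "cay_nbrs G S" "homesick_trans G S lam" ellipticity
  by (rule elliptic_chain_homesick[OF lam_ge_1])

lemma reaches_word:
  "set ss \<subseteq> S \<Longrightarrow> x \<in> carrier G \<Longrightarrow> reaches (x \<otimes> word_prod G ss) (length ss) x"
proof (induction ss arbitrary: x)
  case Nil
  then show ?case by (simp add: reaches.refl)
next
  case (Cons s ss)
  have s: "s \<in> S" "s \<in> carrier G" using Cons.prems gens_carrier by auto
  have "reaches (x \<otimes> s \<otimes> word_prod G ss) (length ss) (x \<otimes> s)"
    using Cons s by auto
  moreover have "x \<otimes> s \<in> cay_nbrs G S x" using s by (auto simp: cay_nbrs_def)
  ultimately show ?case
    using reaches.step Cons.prems s word_closed[of ss] by (simp add: m_assoc)
qed

lemma reaches_len: "w \<in> carrier G \<Longrightarrow> reaches w (len w) \<one>"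
  using len_word[of w] reaches_word[of _ \<one>] word_closed by fastforce

lemma paths_carrier: "xs \<in> paths n x \<Longrightarrow> x \<in> carrier G \<Longrightarrow> set xs \<subseteq> carrier G"
proof (induction n arbitrary: x xs)
  case (Suc n)
  then obtain y ys where y: "y \<in> cay_nbrs G S x" "ys \<in> paths n y" "xs = x # ys" by auto
  have "y \<in> carrier G" using y Suc.prems gens_carrier by (auto simp: cay_nbrs_def)
  then show ?case using Suc.IH[OF y(2)] Suc.prems y by simp
qed simp

text \<open>\<open>butlast\<close> counts only visits that are followed by a step, each of which
  switches the lamp there; it also matches the count in \<open>green\<close>.\<close>

definition often :: "nat \<Rightarrow> 'a list \<Rightarrow> 'a set" where
  "often m xs = {g \<in> set xs. m < count_list (butlast xs) g}"

text \<open>The summand of a site \<open>w\<close> nearest to the root outside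
  \<open>often m xs\<close> already suffices: all strictly closer sites belong to that set. As the
  open ball has at least \<open>len w\<close> elements and the set at most \<open>N\<close>,
  \<open>w\<close> lies in the ball of radius \<open>N\<close>.\<close>

lemma often_bound:
  assumes q: "0 \<le> q" "q \<le> (1::real)" and xs: "length xs \<le> N"
  shows "q ^ card (often m xs) \<le>
    (\<Sum>w\<in>word_ball N. q ^ card (open_ball (len w)) * of_bool (count_list (butlast xs) w \<le> m))"
proof -
  define A where "A = often m xs"
  have finA: "finite A" by (simp add: A_def often_def)
  have "card A \<le> card (set xs)" by (rule card_mono) (auto simp: A_def often_def)
  then have cardA: "card A \<le> N" using card_length[of xs] xs by linarith
  have "\<exists>w. w \<in> carrier G \<and> w \<notin> A" using infinite_carrier finA by (meson finite_subset subsetI)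
  then obtain w where w: "w \<in> carrier G" "w \<notin> A" and min: "\<And>v. v \<in> carrier G \<Longrightarrow> v \<notin> A \<Longrightarrow> len w \<le> len v"
    using ex_has_least_nat[of "\<lambda>w. w \<in> carrier G \<and> w \<notin> A" _ len] by blast
  have "open_ball (len w) \<subseteq> A" using min by (auto simp: open_ball_def not_le[symmetric])
  then have le: "card (open_ball (len w)) \<le> card A" by (rule card_mono[OF finA])
  then have "len w \<le> N" using card_open_ball_ge[of "len w"] cardA by linarith
  then have wN: "w \<in> word_ball N" using w by (simp add: word_ball_def)
  have cw: "count_list (butlast xs) w \<le> m"
  proof (cases "w \<in> set xs")
    case False
    then have "w \<notin> set (butlast xs)" using in_set_butlastD by fast
    then show ?thesis by (simp add: count_list_0_iff)
  qed (use w in \<open>auto simp: A_def often_def\<close>)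
  have "q ^ card A \<le> q ^ card (open_ball (len w))" using q le by (simp add: power_decreasing)
  also have "\<dots> = q ^ card (open_ball (len w)) * of_bool (count_list (butlast xs) w \<le> m)" using cw by simp
  also have "\<dots> \<le> (\<Sum>w\<in>word_ball N. q ^ card (open_ball (len w)) * of_bool (count_list (butlast xs) w \<le> m))"
    using q by (intro member_le_sum[OF wN]) (auto simp: finite_ball)
  finally show ?thesis by (simp add: A_def)
qed

text \<open>Exchanging the sums over time and over the site \<open>w\<close> produces
  \<open>green\<close> from the root to itself; \<open>green_le\<close> bounds it because
  \<open>w\<close> is reached in \<open>len w\<close> steps.\<close>

lemma return_sum_bound:
  assumes q: "0 \<le> q" "q \<le> (1::real)"
  shows "(\<Sum>n<N. path_expect n \<one> (\<lambda>xs. of_bool (last xs = \<one>) * q ^ card (often m xs)))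
    \<le> (\<Sum>r\<le>N. real (card (word_sphere r)) * (q ^ card (open_ball r) *
         (real (m + 1) * (real (r + 1) / ellipticity ^ r + 1))))"
proof -
  have "(\<Sum>n<N. path_expect n \<one> (\<lambda>xs. of_bool (last xs = \<one>) * q ^ card (often m xs)))
    \<le> (\<Sum>n<N. path_expect n \<one> (\<lambda>xs. \<Sum>w\<in>word_ball N. q ^ card (open_ball (len w)) *
          of_bool (last xs = \<one> \<and> count_list (butlast xs) w \<le> m)))"
  proof (intro sum_mono path_expect_mono)
    fix n xs assume "n \<in> {..<N}" "xs \<in> paths n \<one>"
    then have "length xs \<le> N" using pathsD by fastforce
    from often_bound[OF q this, of m]
    show "of_bool (last xs = \<one>) * q ^ card (often m xs) \<le> (\<Sum>w\<in>word_ball N. q ^ card (open_ball (len w)) *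
          of_bool (last xs = \<one> \<and> count_list (butlast xs) w \<le> m))"
      by (cases "last xs = \<one>") auto
  qed
  also have "\<dots> = (\<Sum>w\<in>word_ball N. q ^ card (open_ball (len w)) * green \<one> w m N \<one>)"
    unfolding path_expect_sum green_def sum_distrib_left by (rule sum.swap)
  also have "\<dots> \<le> (\<Sum>w\<in>word_ball N. q ^ card (open_ball (len w)) *
      (real (m + 1) * (real (len w + 1) / ellipticity ^ len w + 1)))"
    using q by (intro sum_mono mult_left_mono green_le reaches_len) (auto simp: word_ball_def)
  also have "\<dots> = (\<Sum>r\<le>N. real (card (word_sphere r)) * (q ^ card (open_ball r) *
         (real (m + 1) * (real (r + 1) / ellipticity ^ r + 1))))"
    by (rule sum_word_ball)
  finally show ?thesis .
qed

text \<open>Exponential rate to be beaten: \<open>card S\<close> bounds the growth of spheres, and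
  \<open>lam * card S\<close> is the inverse ellipticity.\<close>

definition growth_const :: real where "growth_const = lam * real (card S) * real (card S)"

lemma growth_const_ge_1: "1 \<le> growth_const"
proof -
  have "1 \<le> real (card S)" using card_gens_pos by simp
  then have "1 * 1 * 1 \<le> growth_const"
    unfolding growth_const_def using lam_ge_1 by (intro mult_mono) auto
  then show ?thesis by simp
qed

text \<open>The constant 4 is spent as two factors 2: one absorbs the polynomial
  \<open>r + 2 \<le> 2 * 2 ^ r\<close>, the other leaves a geometric series of ratio
  \<open>1 / 2\<close>.\<close>

lemma summable_return:
  assumes q: "0 \<le> q" "q \<le> (1::real)"
    and small: "q ^ c * (4 * growth_const) \<le> 1" and growth: "\<And>r. r0 \<le> r \<Longrightarrow> c * r \<le> card (open_ball r)"
  shows "summable (\<lambda>n. path_expect n \<one> (\<lambda>xs. of_bool (last xs = \<one>) * q ^ card (often m xs)))"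
proof -
  define T where "T = growth_const"
  have T1: "1 \<le> T" unfolding T_def by (rule growth_const_ge_1)
  define f where "f r = real (card (word_sphere r)) * (q ^ card (open_ball r) *
         (real (m + 1) * (real (r + 1) / ellipticity ^ r + 1)))" for r
  have f0: "0 \<le> f r" for r unfolding f_def using q lam_ge_1 by (auto intro!: mult_nonneg_nonneg add_nonneg_nonneg)
  have f_le: "f r \<le> real (m + 1) * 2 * (1 / 2) ^ r" if "r0 \<le> r" for r
  proof -
    have "1 \<le> lam * real (card S)"
      using mult_mono[of 1 lam 1 "real (card S)"] lam_ge_1 card_gens_pos by simp
    then have E1: "1 \<le> (lam * real (card S)) ^ r" by simp
    have r2: "real r + 2 \<le> 2 * 2 ^ r"
    proof (induction r)
      case (Suc r)
      then show ?case by simp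
    qed simp
    have "real (r + 1) / ellipticity ^ r + 1 = real (r + 1) * (lam * real (card S)) ^ r + 1"
      by (simp add: power_one_over)
    also have "\<dots> \<le> (real r + 2) * (lam * real (card S)) ^ r"
      using E1 by (simp add: algebra_simps)
    also have "\<dots> \<le> (2 * 2 ^ r) * (lam * real (card S)) ^ r"
      using r2 E1 by (intro mult_right_mono) auto
    finally have b: "real (r + 1) / ellipticity ^ r + 1 \<le> (2 * 2 ^ r) * (lam * real (card S)) ^ r" .
    have s: "real (card (word_sphere r)) \<le> real (card S) ^ r"
      using card_sphere_le[of r] by (metis of_nat_le_iff of_nat_power)
    have "q ^ card (open_ball r) \<le> q ^ (c * r)" using q growth[OF that] by (simp add: power_decreasing)
    also have "\<dots> = (q ^ c) ^ r" by (simp add: power_mult)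
    also have "\<dots> \<le> (1 / (4 * T)) ^ r"
      using small T1 q by (intro power_mono) (auto simp: T_def field_simps)
    finally have a: "q ^ card (open_ball r) \<le> (1 / (4 * T)) ^ r" .
    have "f r \<le> real (card S) ^ r * ((1 / (4 * T)) ^ r *
         (real (m + 1) * ((2 * 2 ^ r) * (lam * real (card S)) ^ r)))"
      unfolding f_def using s a b q T1 lam_ge_1 by (intro mult_mono) auto
    also have "\<dots> = real (m + 1) * 2 * (real (card S) * (1 / (4 * T)) * 2 * (lam * real (card S))) ^ r"
      by (simp only: power_mult_distrib mult_ac)
    also have "real (card S) * (1 / (4 * T)) * 2 * (lam * real (card S)) = 1 / 2"
      using lam_ge_1 card_gens_pos by (simp add: T_def growth_const_def field_simps)
    finally show ?thesis .
  qed
  have "summable (\<lambda>r. real (m + 1) * 2 * (1 / 2 :: real) ^ r)"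
    by (intro summable_mult summable_geometric) simp
  then have sf: "summable f"
    by (rule summable_comparison_test'[of _ r0]) (use f_le f0 in auto)
  show ?thesis
  proof (rule bounded_imp_summable)
    show "0 \<le> path_expect n \<one> (\<lambda>xs. of_bool (last xs = \<one>) * q ^ card (often m xs))" for n
      unfolding path_expect_eq_sum using q by (auto intro!: sum_nonneg mult_nonneg_nonneg path_weight_nonneg)
    fix n
    have "(\<Sum>k\<le>n. path_expect k \<one> (\<lambda>xs. of_bool (last xs = \<one>) * q ^ card (often m xs))) \<le> (\<Sum>r\<le>Suc n. f r)"
      using return_sum_bound[OF q, where N = "Suc n" and m = m] unfolding f_def lessThan_Suc_atMost .
    also have "\<dots> \<le> suminf f" by (rule sum_le_suminf[OF sf]) (auto intro: f0)
    finally show "(\<Sum>k\<le>n. path_expect k \<one> (\<lambda>xs. of_bool (last xs = \<one>) * q ^ card (often m xs))) \<le> suminf f" .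
  qed
qed

end

section \<open>Transience\<close>

locale lamplighter = homesick_walk G S lam + lamp: lamp_walk H \<mu>
  for G :: "('g, 'b) monoid_scheme" (structure) and S lam
    and H :: "('h, 'c) monoid_scheme" and \<mu> +
  fixes M :: "'w measure" and Z :: "nat \<Rightarrow> 'w \<Rightarrow> 'g" and U V :: "nat \<Rightarrow> 'w \<Rightarrow> 'h"
  assumes process: "lamplighter_process M G S lam \<mu> Z U V"
begin

sublocale prob_space M
  using process by (simp add: lamplighter_process_def)

definition cyl :: "nat \<Rightarrow> 'g list \<Rightarrow> (nat \<Rightarrow> 'h \<times> 'h) \<Rightarrow> 'w set" where
  "cyl n xs uv = {\<omega> \<in> space M. \<forall>i\<le>n. Z i \<omega> = xs ! i \<and>
      (0 < i \<longrightarrow> U i \<omega> = fst (uv i) \<and> V i \<omega> = snd (uv i))}"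

lemma cyl_sets: "cyl n xs uv \<in> events"
proof -
  have [measurable]: "Z i \<in> measurable M (count_space UNIV)" "U i \<in> measurable M (count_space UNIV)"
    "V i \<in> measurable M (count_space UNIV)" for i
    using process by (auto simp: lamplighter_process_def)
  show ?thesis unfolding cyl_def by measurable
qed

lemma prob_cyl:
  assumes "xs \<in> paths n \<one>"
  shows "prob (cyl n xs uv) = path_weight n xs * lamp.switch_weight n uv"
proof -
  have fdd: "\<And>n z u v. measure M {\<omega> \<in> space M. \<forall>i\<le>n. Z i \<omega> = z i \<and>
                              (0 < i \<longrightarrow> U i \<omega> = u i \<and> V i \<omega> = v i)} =
        (if z 0 = \<one> then (\<Prod>i<n. homesick_trans G S lam (z i) (z (Suc i))) else 0) *
        (\<Prod>i\<in>{1..n}. pmf \<mu> (u i) * pmf \<mu> (v i))"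
    using process unfolding lamplighter_process_def by blast
  show ?thesis
    using fdd[of n "\<lambda>i. xs ! i" "\<lambda>i. fst (uv i)" "\<lambda>i. snd (uv i)"] pathsD[OF assms]
    by (simp add: cyl_def path_weight_def lamp.switch_weight_def)
qed

lemma cyl_disjoint:
  assumes "xs \<in> paths n \<one>" "ys \<in> paths n \<one>" "uv \<in> lamp.switches n" "uv' \<in> lamp.switches n"
    and "\<omega> \<in> cyl n xs uv" "\<omega> \<in> cyl n ys uv'"
  shows "xs = ys \<and> uv = uv'"
proof
  have "xs ! i = ys ! i" if "i \<le> n" for i
    using assms(5,6) that unfolding cyl_def by auto
  then show "xs = ys" using pathsD[OF assms(1)] pathsD[OF assms(2)] by (auto intro: nth_equalityI)
  show "uv = uv'"
    using assms(3,4) unfolding lamp.switches_def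
  proof (rule PiE_ext)
    fix i assume "i \<in> {1..n}"
    then have "0 < i" "i \<le> n" by auto
    then have "fst (uv i) = fst (uv' i)" "snd (uv i) = snd (uv' i)"
      using assms(5,6) unfolding cyl_def by auto
    then show "uv i = uv' i" by (rule prod_eqI)
  qed
qed

text \<open>The cylinders over admissible paths and switches are disjoint and their probabilities
  sum to 1, so whatever lies outside them is null.\<close>

lemma AE_cyl: "AE \<omega> in M. \<exists>xs\<in>paths n \<one>. \<exists>uv\<in>lamp.switches n. \<omega> \<in> cyl n xs uv"
proof -
  define I where "I = paths n \<one> \<times> lamp.switches n"
  have "prob (\<Union>p\<in>I. cyl n (fst p) (snd p)) = (\<Sum>p\<in>I. prob (cyl n (fst p) (snd p)))"
  proof (rule finite_measure_finite_Union)
    show "finite I" by (simp add: I_def lamp.finite_switches)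
    show "(\<lambda>p. cyl n (fst p) (snd p)) ` I \<subseteq> events" using cyl_sets by auto
    show "disjoint_family_on (\<lambda>p. cyl n (fst p) (snd p)) I"
      unfolding disjoint_family_on_def I_def using cyl_disjoint by fastforce
  qed
  also have "\<dots> = (\<Sum>p\<in>I. path_weight n (fst p) * lamp.switch_weight n (snd p))"
    by (rule sum.cong) (auto simp: I_def prob_cyl)
  also have "\<dots> = (\<Sum>xs\<in>paths n \<one>. path_weight n xs * (\<Sum>uv\<in>lamp.switches n. lamp.switch_weight n uv))"
    by (simp add: I_def sum.cartesian_product case_prod_unfold sum_distrib_left)
  also have "\<dots> = path_expect n \<one> (\<lambda>_. 1)"
    by (simp add: lamp.sum_switch_weight path_expect_eq_sum)
  finally have "prob (\<Union>p\<in>I. cyl n (fst p) (snd p)) = 1" by (simp add: path_expect_1)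
  from AE_prob_1[OF this] show ?thesis by eventually_elim (auto simp: I_def)
qed

definition good :: "nat \<Rightarrow> 'g list \<Rightarrow> (nat \<Rightarrow> 'h \<times> 'h) \<Rightarrow> bool" where
  "good n xs uv \<longleftrightarrow> last xs = \<one> \<and> (\<forall>g\<in>set xs. lamp.lamp ((!) xs) uv n g = \<one>\<^bsub>H\<^esub>)"

text \<open>A finite union of cylinders, hence measurable and of computable probability, that
  contains the return event at time \<open>n\<close> up to a null set.\<close>

definition returns :: "nat \<Rightarrow> 'w set" where
  "returns n = (\<Union>p\<in>{p \<in> paths n \<one> \<times> lamp.switches n. good n (fst p) (snd p)}. cyl n (fst p) (snd p))"

lemma AE_returns:
  "AE \<omega> in M. Z n \<omega> = \<one> \<and> (\<forall>g\<in>carrier G. lamps H Z U V n \<omega> g = \<one>\<^bsub>H\<^esub>) \<longrightarrow> \<omega> \<in> returns n"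
  using AE_cyl[of n]
proof eventually_elim
  case (elim \<omega>)
  then obtain xs uv where xs: "xs \<in> paths n \<one>" "uv \<in> lamp.switches n" "\<omega> \<in> cyl n xs uv" by blast
  show ?case
  proof
    assume ret: "Z n \<omega> = \<one> \<and> (\<forall>g\<in>carrier G. lamps H Z U V n \<omega> g = \<one>\<^bsub>H\<^esub>)"
    have "lamps H Z U V n \<omega> = lamp.lamp ((!) xs) uv n"
      unfolding lamp.lamps_eq_lamp
      by (rule lamp.lamp_cong) (use xs(3) in \<open>auto simp: cyl_def prod_eq_iff\<close>)
    moreover have "set xs \<subseteq> carrier G" using paths_carrier[OF xs(1)] by simp
    moreover have "last xs = Z n \<omega>"
      using xs(3) pathsD[OF xs(1)] last_conv_nth[of xs] by (cases xs) (auto simp: cyl_def)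
    ultimately have "good n xs uv" using ret by (auto simp: good_def)
    then show "\<omega> \<in> returns n" using xs unfolding returns_def by force
  qed
qed

lemma count_le_lamp_steps: "count_list (map z [0..<n]) g \<le> lamp.lamp_steps z n g"
  by (induction n) auto

text \<open>By \<open>sum_lamp_eq\<close> the left side is a product over visited sites; sites in
  \<open>often m xs\<close> have had more than \<open>m\<close> switches and give a factor at most
  \<open>q\<close>, the others at most 1.\<close>

lemma lamp_return_le:
  assumes xs: "xs \<in> paths n \<one>" and q: "0 \<le> q"
    and conv: "\<And>j. m < j \<Longrightarrow> lamp.conv j \<one>\<^bsub>H\<^esub> \<le> q"
  shows "(\<Sum>uv\<in>lamp.switches n. lamp.switch_weight n uv * of_bool (\<forall>g\<in>set xs. lamp.lamp ((!) xs) uv n g = \<one>\<^bsub>H\<^esub>))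
    \<le> q ^ card (often m xs)"
proof -
  have len: "length xs = Suc n" using pathsD[OF xs] by simp
  have "butlast xs = map ((!) xs) [0..<n]"
    by (rule nth_equalityI) (auto simp: len nth_butlast)
  then have steps: "count_list (butlast xs) g \<le> lamp.lamp_steps ((!) xs) n g" for g
    using count_le_lamp_steps by metis
  have "(\<Sum>uv\<in>lamp.switches n. lamp.switch_weight n uv * of_bool (\<forall>g\<in>set xs. lamp.lamp ((!) xs) uv n g = \<one>\<^bsub>H\<^esub>))
    = (\<Prod>g\<in>set xs. lamp.conv (lamp.lamp_steps ((!) xs) n g) \<one>\<^bsub>H\<^esub>)"
    by (rule lamp.sum_lamp_eq) (auto simp: len)
  also have "\<dots> \<le> (\<Prod>g\<in>set xs. if m < count_list (butlast xs) g then q else 1)"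
  proof (intro prod_mono conjI lamp.conv_nonneg)
    fix g
    show "lamp.conv (lamp.lamp_steps ((!) xs) n g) \<one>\<^bsub>H\<^esub> \<le> (if m < count_list (butlast xs) g then q else 1)"
      using conv[of "lamp.lamp_steps ((!) xs) n g"] steps[of g] lamp.conv_le_1[OF lamp.one_closed] by auto
  qed
  also have "\<dots> = q ^ card (often m xs)"
    by (simp add: often_def flip: prod.inter_filter)
  finally show ?thesis .
qed

lemma prob_returns_le:
  assumes q: "0 \<le> q" and conv: "\<And>j. m < j \<Longrightarrow> lamp.conv j \<one>\<^bsub>H\<^esub> \<le> q"
  shows "prob (returns n) \<le> path_expect n \<one> (\<lambda>xs. of_bool (last xs = \<one>) * q ^ card (often m xs))"
proof -
  let ?I = "paths n \<one> \<times> lamp.switches n"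
  have fin: "finite ?I" by (simp add: lamp.finite_switches)
  have "prob (returns n) \<le> (\<Sum>p\<in>{p \<in> ?I. good n (fst p) (snd p)}. prob (cyl n (fst p) (snd p)))"
    unfolding returns_def using fin cyl_sets by (intro finite_measure_subadditive_finite) auto
  also have "\<dots> = (\<Sum>p\<in>?I. path_weight n (fst p) * (lamp.switch_weight n (snd p) * of_bool (good n (fst p) (snd p))))"
    unfolding sum.inter_filter[OF fin] by (rule sum.cong) (auto simp: prob_cyl)
  also have "\<dots> = (\<Sum>xs\<in>paths n \<one>. path_weight n xs *
      (\<Sum>uv\<in>lamp.switches n. lamp.switch_weight n uv * of_bool (good n xs uv)))"
    by (simp add: sum.cartesian_product case_prod_unfold sum_distrib_left)
  also have "\<dots> = path_expect n \<one> (\<lambda>xs. \<Sum>uv\<in>lamp.switches n. lamp.switch_weight n uv * of_bool (good n xs uv))"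
    by (simp add: path_expect_eq_sum)
  also have "\<dots> \<le> path_expect n \<one> (\<lambda>xs. of_bool (last xs = \<one>) * q ^ card (often m xs))"
  proof (rule path_expect_mono)
    fix xs assume "xs \<in> paths n \<one>"
    from lamp_return_le[OF this q conv]
    show "(\<Sum>uv\<in>lamp.switches n. lamp.switch_weight n uv * of_bool (good n xs uv))
        \<le> of_bool (last xs = \<one>) * q ^ card (often m xs)"
      by (cases "last xs = \<one>") (auto simp: good_def)
  qed
  finally show ?thesis .
qed

text \<open>Borel-Cantelli for the events \<open>returns n\<close>. The two cases of the theorem
  differ only in the choice of \<open>q\<close>, \<open>m\<close> and \<open>c\<close>.\<close>

lemma transient:
  assumes q: "0 \<le> q" "q \<le> 1" and conv: "\<And>j. m < j \<Longrightarrow> lamp.conv j \<one>\<^bsub>H\<^esub> \<le> q"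
    and small: "q ^ c * (4 * growth_const) \<le> 1" and growth: "\<And>r. r0 \<le> r \<Longrightarrow> c * r \<le> card (open_ball r)"
  shows "lamplighter_transient M G H Z U V"
proof -
  have "summable (\<lambda>n. prob (returns n))"
  proof (rule summable_comparison_test')
    show "summable (\<lambda>n. path_expect n \<one> (\<lambda>xs. of_bool (last xs = \<one>) * q ^ card (often m xs)))"
      by (rule summable_return[OF q small growth])
    show "norm (prob (returns n)) \<le> path_expect n \<one> (\<lambda>xs. of_bool (last xs = \<one>) * q ^ card (often m xs))"
      if "0 \<le> n" for n
      using prob_returns_le[OF q(1) conv, of m n] by simp
  qed
  moreover have "returns n \<in> events" for n
    unfolding returns_def by (intro sets.finite_UN) (auto simp: lamp.finite_switches cyl_sets)
  ultimately have "AE \<omega> in M. eventually (\<lambda>n. \<omega> \<in> space M - returns n) sequentially"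
    by (intro borel_cantelli_AE1) (auto simp: less_top[symmetric])
  moreover have "AE \<omega> in M. \<forall>n. Z n \<omega> = \<one> \<and> (\<forall>g\<in>carrier G. lamps H Z U V n \<omega> g = \<one>\<^bsub>H\<^esub>) \<longrightarrow> \<omega> \<in> returns n"
    unfolding AE_all_countable using AE_returns by blast
  ultimately show ?thesis
    unfolding lamplighter_transient_def
  proof eventually_elim
    case (elim \<omega>)
    then obtain N where N: "\<And>n. N \<le> n \<Longrightarrow> \<omega> \<notin> returns n" by (auto simp: eventually_sequentially)
    have "{n. Z n \<omega> = \<one> \<and> (\<forall>g\<in>carrier G. lamps H Z U V n \<omega> g = \<one>\<^bsub>H\<^esub>)} \<subseteq> {..<N}"
    proof
      fix n assume "n \<in> {n. Z n \<omega> = \<one> \<and> (\<forall>g\<in>carrier G. lamps H Z U V n \<omega> g = \<one>\<^bsub>H\<^esub>)}"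
      then have "\<omega> \<in> returns n" using elim(2) by blast
      then show "n \<in> {..<N}" using N[of n] by (meson lessThan_iff not_le)
    qed
    then show ?case by (rule finite_subset) simp
  qed
qed

end

theorem theorem1p5:
  fixes G :: "'g monoid" and S :: "'g set" and H :: "'h monoid" and \<mu> :: "'h pmf"
  assumes G: "group G" "fin_gen_group G" "infinite (carrier G)"
      and S: "finite S" "S \<subseteq> carrier G" "\<forall>s\<in>S. inv\<^bsub>G\<^esub> s \<in> S" "generate G S = carrier G"
      and H: "group H" "fin_gen_group H" "carrier H \<noteq> {\<one>\<^bsub>H\<^esub>}"
      and cases:
        "(\<not> virtually_Z G \<and> finite (carrier H) \<and> \<mu> = pmf_of_set (carrier H)) \<or>
         (infinite (carrier H) \<and> set_pmf \<mu> \<subseteq> carrier H \<and> finite (set_pmf \<mu>) \<and>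
          (\<forall>h\<in>carrier H. pmf \<mu> (inv\<^bsub>H\<^esub> h) = pmf \<mu> h) \<and>
          generate H (set_pmf \<mu>) = carrier H)"
  shows "\<forall>lam::real. lam \<ge> 1 \<longrightarrow>
           (\<forall>(M :: 'a measure) Z U V. lamplighter_process M G S lam \<mu> Z U V \<longrightarrow>
              lamplighter_transient M G H Z U V)"
proof (intro allI impI)
  fix lam :: real and M :: "'a measure" and Z U V
  assume lam: "lam \<ge> 1" and process: "lamplighter_process M G S lam \<mu> Z U V"
  interpret H: group H by fact
  have ne: "carrier H \<noteq> {}" using H.one_closed by blast
  have supp: "set_pmf \<mu> \<subseteq> carrier H \<and> finite (set_pmf \<mu>)"
    using cases set_pmf_of_set[OF ne] by auto
  interpret lamplighter G S lam H \<mu> M Z U V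
    using G(1,3) S H(1) supp lam process
    by (simp add: lamplighter_def lamplighter_axioms_def homesick_walk_def homesick_walk_axioms_def
        infinite_cayley_graph_def infinite_cayley_graph_axioms_def symmetric_generators_def
        symmetric_generators_axioms_def lamp_walk_def lamp_walk_axioms_def)
  show "lamplighter_transient M G H Z U V"
    using cases
  proof
    assume i: "\<not> virtually_Z G \<and> finite (carrier H) \<and> \<mu> = pmf_of_set (carrier H)"
    \<comment> \<open>A single uniform switch already equidistributes the lamp, so
      \<open>m = 0\<close> works with this \<open>q\<close>.\<close>
    define q where "q = 1 / real (card (carrier H))"
    have "1 < card (carrier H)"
    proof -
      obtain h where "h \<in> carrier H" "h \<noteq> \<one>\<^bsub>H\<^esub>" using H(3) H.one_closed by blast
      then have "card {h, \<one>\<^bsub>H\<^esub>} \<le> card (carrier H)" using i by (intro card_mono) auto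
      then show ?thesis using \<open>h \<noteq> \<one>\<^bsub>H\<^esub>\<close> by simp
    qed
    then have q: "0 \<le> q" "q < 1" by (auto simp: q_def)
    obtain c where c: "q ^ c < 1 / (4 * growth_const)"
      using real_arch_pow_inv[OF _ q(2), of "1 / (4 * growth_const)"] growth_const_ge_1 by auto
    \<comment> \<open>The open ball of radius \<open>r\<close> is the ball of radius
      \<open>r - 1\<close>; the factor 2 makes up for this shift once
      \<open>r \<ge> 2\<close>.\<close>
    obtain N where N: "\<And>n. N \<le> n \<Longrightarrow> 2 * c * n \<le> card (word_ball n)"
      using superlinear_growth[of "2 * c"] i by blast
    show ?thesis
    proof (rule transient[of q 0 c "N + 2"])
      fix j :: nat assume "0 < j"
      then obtain k where "j = Suc k" by (cases j) auto
      then show "lamp.conv j \<one>\<^bsub>H\<^esub> \<le> q" using lamp.conv_uniform[of "\<one>\<^bsub>H\<^esub>" k] i by (simp add: q_def del: lamp.conv.simps)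
    next
      show "q ^ c * (4 * growth_const) \<le> 1" using c growth_const_ge_1 by (simp add: field_simps)
    next
      fix r assume r: "N + 2 \<le> r"
      then obtain n where n: "r = Suc n" by (cases r) auto
      have "c * r \<le> 2 * c * n" using r n by (simp add: algebra_simps)
      also have "\<dots> \<le> card (open_ball r)" using N[of n] r n by (simp add: open_ball_Suc)
      finally show "c * r \<le> card (open_ball r)" .
    qed (use q in auto)
  next
    assume ii: "infinite (carrier H) \<and> set_pmf \<mu> \<subseteq> carrier H \<and> finite (set_pmf \<mu>) \<and>
          (\<forall>h\<in>carrier H. pmf \<mu> (inv\<^bsub>H\<^esub> h) = pmf \<mu> h) \<and> generate H (set_pmf \<mu>) = carrier H"
    have "inv\<^bsub>H\<^esub> s \<in> set_pmf \<mu>" if "s \<in> set_pmf \<mu>" for s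
      using that ii by (auto simp: set_pmf_iff subset_iff)
    then have lim: "lamp.conv_sup \<longlonglongrightarrow> 0" using ii by (intro lamp.conv_sup_tendsto_0) auto
    \<comment> \<open>Small enough to work with \<open>c = 1\<close>, so the linear bound
      \<open>card_open_ball_ge\<close> is sufficient growth; the decay of \<open>conv_sup\<close>
      then supplies \<open>m\<close>.\<close>
    define q where "q = 1 / (4 * growth_const)"
    have q: "0 < q" "q \<le> 1" using growth_const_ge_1 by (auto simp: q_def)
    obtain m where m: "\<And>j. m \<le> j \<Longrightarrow> lamp.conv_sup j < q"
      using order_tendstoD(2)[OF lim q(1)] by (auto simp: eventually_sequentially)
    show ?thesis
    proof (rule transient[of q m 1 0])
      fix j assume "m < j"
      then show "lamp.conv j \<one>\<^bsub>H\<^esub> \<le> q"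
        using m[of j] lamp.conv_le_sup[OF H.one_closed, of j] by linarith
    next
      show "q ^ 1 * (4 * growth_const) \<le> 1" using growth_const_ge_1 by (simp add: q_def)
    qed (use q card_open_ball_ge in auto)
  qed
qed

end
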